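(* Let $\Omega\subset\mathbb{R}^N$ be a bounded open set with boundary $\Gamma\in C^2$, let $\mathbf{A}\in (C^1(\overline{\Omega}))^N$ be a real time-independent vector potential, and let $T>0$. Let $b:(0,T]\to\mathbb{R}$ satisfy: (I) there are $C_1,C_2>0$ with $C_1\le \inf_{t\in(0,T]}b(t)\le \sup_{t\in(0,T]}b(t)\le C_2$; (II) $b\in C^2(0,T]$ and there is $C_3>0$ with $\left|\frac{d^k}{dt^k}b(t)\right|\le C_3\left(\nu(t)/t\right)^k$ for all $t\in(0,T]$ and $k=1,2$, where $\nu\in C(0,T]$ is a positive, strictly decreasing function with $\inf_{t\in(0,T]}\nu(t)\ge C_4>0$. Put $\mu(t):=t/\nu(t)$, a strictly increasing function on $(0,T]$, with inverse function $\mu^{-1}$. Let $s\ge 1$. Then there exist a positive integer $P$ and a constant $c_1>0$ such that for all $(u_0,u_1)\in H^s\times H^{s-1}$ the problem $$u_{tt}+b^2(t)(i\nabla+\mathbf{A}(x))^2u=0 \text{ in }(0,T)\times\Omega,\quad u=0\text{ on }(0,T)\times\Gamma,\quad u(0,x)=u_0(x),\ u_t(0,x)=u_1(x)\text{ in }\Omega$$ has a unique solution $u$ with $$u\in C\Big([0,T];\exp\Big(c_1\nu\big(\mu^{-1}(2^P/\sqrt{(i\nabla+\mathbf{A}(x))^2})\big)\Big)H^s\Big),$$ $$u_t\in C\Big([0,T];\exp\Big(c_1\nu\big(\mu^{-1}(2^P/\sqrt{(i\nabla+\mathbf{A}(x))^2})\big)\Big)H^{s-1}\Big).$$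
   Context: Write $\mathscr{H}_{\mathbf A}=i\nabla+\mathbf{A}(x)$ and $\mathscr{H}_{\mathbf A}^2=(i\nabla+\mathbf{A}(x))^2=\sum_{j=1}^N(i\partial_{x_j}+a_j(x))^2$, $\mathbf{A}=(a_1,\dots,a_N)$. With homogeneous Dirichlet boundary conditions on $\Omega$, $\mathscr{H}_{\mathbf A}^2$ is positive and self-adjoint with discrete spectrum $\Lambda=\{\lambda_k^2\}_k$, $0<\lambda_1^2\le\lambda_2^2\le\cdots\to\infty$ (finite multiplicities, eigenvalues repeated accordingly), and it has eigenfunctions $\phi_\lambda$ ($\lambda^2\in\Lambda$, $\lambda>0$) forming an orthonormal basis of $L^2(\Omega)$. The generalized Fourier coefficients are $\hat f(\lambda)=\langle f,\phi_\lambda\rangle$ ($L^2$ product or its duality extension), and $f=\sum_{\lambda^2\in\Lambda}\hat f(\lambda)\phi_\lambda$. The Sobolev spaces $H^s$ are those associated with this expansion: $\|f\|_{H^s}^2=\sum_{\lambda^2\in\Lambda}\lambda^{2s}|\hat f(\lambda)|^2<\infty$. For a function $F$ on $(0,\infty)$, $F(\sqrt{\mathscr{H}_{\mathbf A}^2})$ is the operator multiplying $\hat f(\lambda)$ by $F(\lambda)$. With $F(\lambda)=\exp(c_1\nu(\mu^{-1}(2^P/\lambda)))$, the space $F(\sqrt{\mathscr{H}_{\mathbf A}^2})H^s$ is the image of $H^s$ under this operator, i.e. the space of (possibly formal) series $\sum_{\lambda^2\in\Lambda} f_\lambda\phi_\lambda$ with finite norm $\big(\sum_{\lambda^2\in\Lambda}\lambda^{2s}F(\lambda)^{-2}|f_\lambda|^2\big)^{1/2}$.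 For the finitely many $\lambda$ with $2^P/\lambda>\mu(T)$, $\mu^{-1}(2^P/\lambda)$ is taken to be $T$. A solution is understood through the expansion: for each $\lambda^2\in\Lambda$ the coefficient $\hat u(\cdot,\lambda)\in C^1[0,T]\cap C^2(0,T]$ satisfies $\hat u_{tt}+\lambda^2b^2(t)\hat u=0$ on $(0,T]$, $\hat u(0,\lambda)=\hat u_0(\lambda)$, $\hat u_t(0,\lambda)=\hat u_1(\lambda)$; the boundary condition is encoded in the Dirichlet eigenfunctions. *)

theory Defs
  imports "HOL-Analysis.Analysis"
begin

section \<open>Classical smoothness\<close>

definition pdiff :: "'n \<Rightarrow> (real^'n \<Rightarrow> 'b::real_normed_vector) \<Rightarrow> real^'n \<Rightarrow> 'b" where
  "pdiff j f x = frechet_derivative f (at x) (axis j 1)"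

text \<open>The class \<open>C\<^sup>k(S)\<close>, intended for open \<open>S\<close>.\<close>

primrec Ck_on :: "nat \<Rightarrow> (real^'n) set \<Rightarrow> (real^'n \<Rightarrow> 'b::real_normed_vector) \<Rightarrow> bool" where
  "Ck_on 0 S f \<longleftrightarrow> continuous_on S f"
| "Ck_on (Suc k) S f \<longleftrightarrow>
     (\<forall>x\<in>S. f differentiable (at x)) \<and> (\<forall>j. Ck_on k S (pdiff j f))"

text \<open>The class \<open>C\<^sup>1\<close> of the closure of an open set: \<open>f\<close> and its first partial derivatives
  extend continuously from the open set to its closure.\<close>

definition C1_closure :: "(real^'n) set \<Rightarrow> (real^'n \<Rightarrow> real) \<Rightarrow> bool" where
  "C1_closure \<Omega> f \<longleftrightarrow> Ck_on 1 \<Omega> f \<and> continuous_on (closure \<Omega>) f \<and>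
     (\<forall>j. \<exists>g. continuous_on (closure \<Omega>) g \<and> (\<forall>x\<in>\<Omega>. g x = pdiff j f x))"

text \<open>Near each boundary point the set is the strict epigraph of a \<open>C\<^sup>2\<close> function in suitably
  rotated coordinates. The direction of the graph is the unit vector \<open>e\<close>; \<open>\<gamma>\<close> is only evaluated on
  the hyperplane orthogonal to \<open>e\<close>, so requiring it to be \<open>C\<^sup>2\<close> on the whole space is no restriction.\<close>

definition C2_boundary :: "(real^'n) set \<Rightarrow> bool" where
  "C2_boundary \<Omega> \<longleftrightarrow> (\<forall>x0\<in>frontier \<Omega>. \<exists>r>0. \<exists>e. \<exists>\<gamma> :: real^'n \<Rightarrow> real.
     norm e = 1 \<and> Ck_on 2 UNIV \<gamma> \<and>
     \<Omega> \<inter> ball x0 r = {x \<in> ball x0 r. \<gamma> (x - (x \<bullet> e) *\<^sub>R e) < x \<bullet> e})"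


section \<open>Lebesgue and Sobolev spaces of complex-valued functions\<close>

definition test_functions :: "(real^'n) set \<Rightarrow> (real^'n \<Rightarrow> complex) set" where
  "test_functions \<Omega> = {\<psi>. (\<forall>k. Ck_on k UNIV \<psi>) \<and>
     compact (closure {x. \<psi> x \<noteq> 0}) \<and> closure {x. \<psi> x \<noteq> 0} \<subseteq> \<Omega>}"

text \<open>Functions are not identified when they agree almost everywhere, and their values outside
  \<open>\<Omega>\<close> are irrelevant.\<close>

definition L2 :: "(real^'n) set \<Rightarrow> (real^'n \<Rightarrow> complex) set" where
  "L2 \<Omega> = {f \<in> borel_measurable (lebesgue_on \<Omega>).
     integrable (lebesgue_on \<Omega>) (\<lambda>x. (cmod (f x))\<^sup>2)}"

definition L2_inner :: "(real^'n) set \<Rightarrow> (real^'n \<Rightarrow> complex) \<Rightarrow> (real^'n \<Rightarrow> complex) \<Rightarrow> complex" where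
  "L2_inner \<Omega> f g = (LINT x|lebesgue_on \<Omega>. f x * cnj (g x))"

definition L2_dist :: "(real^'n) set \<Rightarrow> (real^'n \<Rightarrow> complex) \<Rightarrow> (real^'n \<Rightarrow> complex) \<Rightarrow> real" where
  "L2_dist \<Omega> f g = sqrt (LINT x|lebesgue_on \<Omega>. (cmod (f x - g x))\<^sup>2)"

definition weak_pdiff ::
  "(real^'n) set \<Rightarrow> 'n \<Rightarrow> (real^'n \<Rightarrow> complex) \<Rightarrow> (real^'n \<Rightarrow> complex) \<Rightarrow> bool" where
  "weak_pdiff \<Omega> j f g \<longleftrightarrow> f \<in> L2 \<Omega> \<and> g \<in> L2 \<Omega> \<and>
     (\<forall>\<psi>\<in>test_functions \<Omega>.
        (LINT x|lebesgue_on \<Omega>. f x * pdiff j \<psi> x) = - (LINT x|lebesgue_on \<Omega>. g x * \<psi> x))"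

definition Sobolev_H1 :: "(real^'n) set \<Rightarrow> (real^'n \<Rightarrow> complex) set" where
  "Sobolev_H1 \<Omega> = {f. \<forall>j. \<exists>g. weak_pdiff \<Omega> j f g}"

definition Sobolev_H2 :: "(real^'n) set \<Rightarrow> (real^'n \<Rightarrow> complex) set" where
  "Sobolev_H2 \<Omega> = {f. \<forall>j. \<exists>g\<in>Sobolev_H1 \<Omega>. weak_pdiff \<Omega> j f g}"

text \<open>The closure of the test functions in \<open>H\<^sup>1(\<Omega>)\<close>.\<close>

definition Sobolev_H10 :: "(real^'n) set \<Rightarrow> (real^'n \<Rightarrow> complex) set" where
  "Sobolev_H10 \<Omega> = {f. \<exists>g. \<exists>\<psi> :: nat \<Rightarrow> real^'n \<Rightarrow> complex.
     (\<forall>j. weak_pdiff \<Omega> j f (g j)) \<and> (\<forall>n. \<psi> n \<in> test_functions \<Omega>) \<and>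
     (\<lambda>n. L2_dist \<Omega> (\<psi> n) f) \<longlonglongrightarrow> 0 \<and>
     (\<forall>j. (\<lambda>n. L2_dist \<Omega> (pdiff j (\<psi> n)) (g j)) \<longlonglongrightarrow> 0)}"


section \<open>The Dirichlet magnetic operator and its eigenbasis\<close>

text \<open>\<open>magnetic_pdiff \<Omega> A j f h\<close> means \<open>h = (i \<partial>\<^sub>j + a\<^sub>j) f\<close>, and \<open>magnetic_op \<Omega> A f h\<close> means
  \<open>h = (i\<nabla> + A)\<^sup>2 f = \<Sum>\<^sub>j (i \<partial>\<^sub>j + a\<^sub>j)\<^sup>2 f\<close>, with weak derivatives. These are relations because weak
  derivatives are only determined almost everywhere.\<close>

definition magnetic_pdiff ::
  "(real^'n) set \<Rightarrow> (real^'n \<Rightarrow> real^'n) \<Rightarrow> 'n \<Rightarrow>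
   (real^'n \<Rightarrow> complex) \<Rightarrow> (real^'n \<Rightarrow> complex) \<Rightarrow> bool" where
  "magnetic_pdiff \<Omega> A j f h \<longleftrightarrow>
     (\<exists>g. weak_pdiff \<Omega> j f g \<and> h = (\<lambda>x. \<i> * g x + of_real (A x $ j) * f x))"

definition magnetic_op ::
  "(real^'n) set \<Rightarrow> (real^'n \<Rightarrow> real^'n) \<Rightarrow>
   (real^'n \<Rightarrow> complex) \<Rightarrow> (real^'n \<Rightarrow> complex) \<Rightarrow> bool" where
  "magnetic_op \<Omega> A f h \<longleftrightarrow>
     (\<exists>d e. (\<forall>j. magnetic_pdiff \<Omega> A j f (d j) \<and> magnetic_pdiff \<Omega> A j (d j) (e j)) \<and>
            h = (\<lambda>x. \<Sum>j\<in>UNIV. e j x))"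

text \<open>For a boundary of class \<open>C\<^sup>2\<close> and a potential of class \<open>C\<^sup>1\<close> up to the boundary, the domain of
  the self-adjoint Dirichlet realisation is \<open>H\<^sup>2(\<Omega>) \<inter> H\<^sup>1\<^sub>0(\<Omega>)\<close>.\<close>

definition Dirichlet_eigenfunction ::
  "(real^'n) set \<Rightarrow> (real^'n \<Rightarrow> real^'n) \<Rightarrow> real \<Rightarrow> (real^'n \<Rightarrow> complex) \<Rightarrow> bool" where
  "Dirichlet_eigenfunction \<Omega> A ev f \<longleftrightarrow>
     f \<in> Sobolev_H2 \<Omega> \<inter> Sobolev_H10 \<Omega> \<and> \<not> (AE x in lebesgue_on \<Omega>. f x = 0) \<and>
     (\<exists>h. magnetic_op \<Omega> A f h \<and> (AE x in lebesgue_on \<Omega>. h x = of_real ev * f x))"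

definition fourier_coeff ::
  "(real^'n) set \<Rightarrow> (nat \<Rightarrow> real^'n \<Rightarrow> complex) \<Rightarrow> (real^'n \<Rightarrow> complex) \<Rightarrow> nat \<Rightarrow> complex" where
  "fourier_coeff \<Omega> \<phi> f k = L2_inner \<Omega> f (\<phi> k)"

definition orthonormal_basis :: "(real^'n) set \<Rightarrow> (nat \<Rightarrow> real^'n \<Rightarrow> complex) \<Rightarrow> bool" where
  "orthonormal_basis \<Omega> \<phi> \<longleftrightarrow>
     (\<forall>k. \<phi> k \<in> L2 \<Omega>) \<and>
     (\<forall>k l. L2_inner \<Omega> (\<phi> k) (\<phi> l) = (if k = l then 1 else 0)) \<and>
     (\<forall>f\<in>L2 \<Omega>. (\<lambda>n. L2_dist \<Omega> f (\<lambda>x. \<Sum>k<n. fourier_coeff \<Omega> \<phi> f k * \<phi> k x)) \<longlonglongrightarrow> 0)"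

text \<open>The eigenvalues are \<open>(lam k)\<^sup>2\<close>, repeated according to multiplicity; that the list is complete
  follows from the basis property.\<close>

definition Dirichlet_eigenbasis ::
  "(real^'n) set \<Rightarrow> (real^'n \<Rightarrow> real^'n) \<Rightarrow> (nat \<Rightarrow> real) \<Rightarrow> (nat \<Rightarrow> real^'n \<Rightarrow> complex) \<Rightarrow> bool" where
  "Dirichlet_eigenbasis \<Omega> A lam \<phi> \<longleftrightarrow>
     (\<forall>k. 0 < lam k) \<and> incseq lam \<and> filterlim lam at_top sequentially \<and>
     orthonormal_basis \<Omega> \<phi> \<and>
     (\<forall>k. Dirichlet_eigenfunction \<Omega> A ((lam k)\<^sup>2) (\<phi> k))"


section \<open>Spaces of (formal) eigenfunction expansions\<close>

text \<open>A possibly formal series \<open>\<Sum>\<^sub>k c\<^sub>k \<phi>\<^sub>k\<close> is represented by its coefficient sequence \<open>c\<close>.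
  The set \<open>weighted_space lam F s\<close> is the image of \<open>H\<^sup>s\<close> under the multiplier \<open>F\<close> of the square root
  of the operator; \<open>F\<close> must be positive on the range of \<open>lam\<close>.\<close>

definition weighted_space :: "(nat \<Rightarrow> real) \<Rightarrow> (real \<Rightarrow> real) \<Rightarrow> real \<Rightarrow> (nat \<Rightarrow> complex) set" where
  "weighted_space lam F s =
     {c. summable (\<lambda>k. lam k powr (2 * s) * F (lam k) powr (-2) * (cmod (c k))\<^sup>2)}"

definition weighted_norm :: "(nat \<Rightarrow> real) \<Rightarrow> (real \<Rightarrow> real) \<Rightarrow> real \<Rightarrow> (nat \<Rightarrow> complex) \<Rightarrow> real" where
  "weighted_norm lam F s c =
     sqrt (\<Sum>k. lam k powr (2 * s) * F (lam k) powr (-2) * (cmod (c k))\<^sup>2)"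

text \<open>The space \<open>H\<^sup>s\<close> for \<open>s \<ge> 0\<close>, where it consists of genuine square-integrable functions.\<close>

definition Hs_space ::
  "(real^'n) set \<Rightarrow> (nat \<Rightarrow> real) \<Rightarrow> (nat \<Rightarrow> real^'n \<Rightarrow> complex) \<Rightarrow> real \<Rightarrow> (real^'n \<Rightarrow> complex) set" where
  "Hs_space \<Omega> lam \<phi> s =
     {f \<in> L2 \<Omega>. summable (\<lambda>k. lam k powr (2 * s) * (cmod (fourier_coeff \<Omega> \<phi> f k))\<^sup>2)}"

definition continuous_into_weighted ::
  "real \<Rightarrow> (nat \<Rightarrow> real) \<Rightarrow> (real \<Rightarrow> real) \<Rightarrow> real \<Rightarrow> (real \<Rightarrow> nat \<Rightarrow> complex) \<Rightarrow> bool" where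
  "continuous_into_weighted T lam F s v \<longleftrightarrow>
     (\<forall>t\<in>{0..T}. v t \<in> weighted_space lam F s) \<and>
     (\<forall>t\<in>{0..T}. ((\<lambda>\<tau>. weighted_norm lam F s (\<lambda>k. v \<tau> k - v t k)) \<longlongrightarrow> 0) (at t within {0..T}))"

text \<open>The inverse of \<open>\<mu>(t) = t / \<nu>(t)\<close> on \<open>(0,T]\<close>, set to \<open>T\<close> for arguments beyond \<open>\<mu>(T)\<close>.\<close>

definition mu_inv :: "(real \<Rightarrow> real) \<Rightarrow> real \<Rightarrow> real \<Rightarrow> real" where
  "mu_inv \<nu> T y = (if y \<le> T / \<nu> T then the_inv_into {0<..T} (\<lambda>t. t / \<nu> t) y else T)"

definition loss_weight :: "(real \<Rightarrow> real) \<Rightarrow> real \<Rightarrow> nat \<Rightarrow> real \<Rightarrow> real \<Rightarrow> real" where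
  "loss_weight \<nu> T P c1 l = exp (c1 * \<nu> (mu_inv \<nu> T (2 ^ P / l)))"


section \<open>Solutions through the expansion\<close>

definition time_deriv :: "real \<Rightarrow> (real \<Rightarrow> nat \<Rightarrow> complex) \<Rightarrow> real \<Rightarrow> nat \<Rightarrow> complex" where
  "time_deriv T u t k = vector_derivative (\<lambda>\<tau>. u \<tau> k) (at t within {0..T})"

text \<open>Each coefficient is in \<open>C\<^sup>1[0,T] \<inter> C\<^sup>2(0,T]\<close> and solves its ordinary differential equation;
  \<open>w\<close> is the second derivative on \<open>(0,T]\<close>.\<close>

definition expansion_solution ::
  "(real^'n) set \<Rightarrow> (nat \<Rightarrow> real) \<Rightarrow> (nat \<Rightarrow> real^'n \<Rightarrow> complex) \<Rightarrow> real \<Rightarrow> (real \<Rightarrow> real) \<Rightarrow>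
   (real^'n \<Rightarrow> complex) \<Rightarrow> (real^'n \<Rightarrow> complex) \<Rightarrow> (real \<Rightarrow> nat \<Rightarrow> complex) \<Rightarrow> bool" where
  "expansion_solution \<Omega> lam \<phi> T b u0 u1 u \<longleftrightarrow> (\<forall>k.
     (\<forall>t\<in>{0..T}. (\<lambda>\<tau>. u \<tau> k) differentiable (at t within {0..T})) \<and>
     continuous_on {0..T} (\<lambda>t. time_deriv T u t k) \<and>
     (\<exists>w. continuous_on {0<..T} w \<and>
        (\<forall>t\<in>{0<..T}.
           ((\<lambda>\<tau>. time_deriv T u \<tau> k) has_vector_derivative w t) (at t within {0<..T}) \<and>
           w t + of_real ((lam k)\<^sup>2 * (b t)\<^sup>2) * u t k = 0)) \<and>
     u 0 k = fourier_coeff \<Omega> \<phi> u0 k \<and>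
     time_deriv T u 0 k = fourier_coeff \<Omega> \<phi> u1 k)"

end

theory Submission
  imports Defs
begin

text \<open>On each eigenfunction the equation becomes \<open>y'' + l\<^sup>2 b(t)\<^sup>2 y = 0\<close>, and everything reduces
  to a bound for \<open>|y'|\<^sup>2 + l\<^sup>2 |y|\<^sup>2\<close> that is uniform in \<open>l\<close> up to the square of the loss weight. The
  time interval is split at \<open>\<tau> = \<mu>\<^sup>-\<^sup>1(2\<^sup>P / l)\<close>, where \<open>l \<tau> = 2\<^sup>P \<nu>(\<tau>)\<close>. Before \<open>\<tau>\<close>, Gronwall's
  inequality for the constant-coefficient energy loses \<open>exp (C l \<tau>)\<close>. After \<open>\<tau>\<close>, an energy with a
  lower-order corrector has logarithmic derivative \<open>O(\<nu>\<^sup>2 / (l t\<^sup>2))\<close>, whose integral is at most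
  \<open>C \<nu>(\<tau>)\<^sup>2 / (l \<tau>)\<close>. Both losses are \<open>exp (C \<nu>(\<tau>))\<close>. Continuity in time then follows by
  dominated convergence of the series.\<close>


section \<open>Linear equations with a coefficient that is singular at the initial time\<close>

text \<open>Boundedness replaces continuity at the left endpoint: the function is measurable off one
  negligible point and dominated by a constant. This admits integrands that oscillate without a
  limit at \<open>t = 0\<close>.\<close>

lemma integrable_on_Icc_of_continuous_on_Ioc:
  fixes f :: "real \<Rightarrow> 'a::euclidean_space"
  assumes "continuous_on {a<..b} f" and "\<And>t. t \<in> {a<..b} \<Longrightarrow> norm (f t) \<le> B"
  shows "f integrable_on {a..b}"
proof -
  have "f \<in> borel_measurable (lebesgue_on {a<..b})"
    by (rule continuous_imp_measurable_on_sets_lebesgue[OF assms(1)]) simp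
  moreover have "(\<lambda>_. B) integrable_on {a<..b}"
    using integrable_const_ivl[of B a b]
    by (rule integrable_spike_set) (auto intro: negligible_subset[of "{a}"])
  ultimately have "f integrable_on {a<..b}"
    using assms(2) by (rule measurable_bounded_by_integrable_imp_integrable) auto
  then show ?thesis
    by (rule integrable_spike_set) (auto intro: negligible_subset[of "{a}"])
qed

lemma has_integral_exp_scaled:
  assumes "K > 0" "0 \<le> (t::real)"
  shows "((\<lambda>r. c * exp (K * r)) has_integral c * (exp (K * t) - 1) / K) {0..t}"
proof -
  have "((\<lambda>r. c * exp (K * r)) has_integral c * exp (K * t) / K - c * exp (K * 0) / K) {0..t}"
    by (rule fundamental_theorem_of_calculus[OF assms(2)])
       (use assms(1) in \<open>auto intro!: derivative_eq_intros simp flip: has_real_derivative_iff_has_vector_derivative\<close>)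
  then show ?thesis by (simp add: right_diff_distrib diff_divide_distrib)
qed

text \<open>The vector field need not extend continuously to \<open>t = 0\<close>, so the solution is produced by
  a contraction for the integral equation. The weight \<open>exp (- 2 * L * t)\<close> makes the contraction
  global on \<open>{0..T}\<close>.\<close>

lemma lipschitz_ode_exists:
  fixes f :: "real \<Rightarrow> 'a \<Rightarrow> 'a::euclidean_space"
  assumes "0 < T" "0 < L"
    and cont: "\<And>z. continuous_on {0<..T} z \<Longrightarrow> continuous_on {0<..T} (\<lambda>t. f t (z t))"
    and zero: "\<And>t. f t 0 = 0"
    and lip: "\<And>t x y. t \<in> {0..T} \<Longrightarrow> norm (f t x - f t y) \<le> L * norm (x - y)"
  obtains z where "continuous_on {0..T} z"
    and "\<And>t. t \<in> {0..T} \<Longrightarrow> z t = z0 + integral {0..t} (\<lambda>r. f r (z r))"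
    and "(\<lambda>r. f r (z r)) integrable_on {0..T}"
proof -
  \<comment> \<open>Integrating \<open>exp (K * r)\<close> gains a factor \<open>1 / K\<close>, so
    this choice gives the contraction constant \<open>L / K = 1/2\<close>. The unknown
    \<open>w\<close> is the solution multiplied by \<open>exp (- K * t)\<close>.\<close>
  define K where "K = 2 * L"
  have K: "K > 0" using assms by (simp add: K_def)
  define g where "g w r = f r (exp (K * r) *\<^sub>R w r)" for w r
  have gint: "g w integrable_on {0..t}" if w: "continuous_on {0..T} w" and t: "t \<in> {0..T}" for w t
  proof -
    have cw: "continuous_on {0..T} (\<lambda>r. exp (K * r) *\<^sub>R w r)"
      by (intro continuous_intros w)
    have "bounded ((\<lambda>r. exp (K * r) *\<^sub>R w r) ` {0..T})"
      by (intro compact_imp_bounded compact_continuous_image cw) simp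
    then obtain B where B: "\<And>r. r \<in> {0..T} \<Longrightarrow> norm (exp (K * r) *\<^sub>R w r) \<le> B"
      unfolding bounded_iff by blast
    have "g w integrable_on {0..T}"
    proof (rule integrable_on_Icc_of_continuous_on_Ioc)
      show "continuous_on {0<..T} (g w)"
        unfolding g_def by (intro cont continuous_on_subset[OF cw]) auto
      show "norm (g w r) \<le> L * B" if "r \<in> {0<..T}" for r
      proof -
        have "norm (g w r) \<le> L * norm (exp (K * r) *\<^sub>R w r)"
          using lip[of r "exp (K * r) *\<^sub>R w r" 0] that zero[of r] by (simp add: g_def)
        also have "\<dots> \<le> L * B"
          using B[of r] that \<open>0 < L\<close> by (intro mult_left_mono) auto
        finally show ?thesis .
      qed
    qed
    then show ?thesis
      using t by (auto elim: integrable_subinterval_real)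
  qed
  define G where "G w t = exp (- K * t) *\<^sub>R (z0 + integral {0..t} (g w))" for w t
  have Gcont: "continuous_on (cbox 0 T) (G w)" if "continuous_on {0..T} w" for w
  proof -
    have "g w integrable_on {0..T}" using gint[OF that] \<open>0 < T\<close> by simp
    then have "continuous_on {0..T} (\<lambda>t. integral {0..t} (g w))"
      by (rule indefinite_integral_continuous_1)
    then show ?thesis
      unfolding G_def box_real by (intro continuous_intros)
  qed
  \<comment> \<open>Clamping the time extends each image constantly beyond \<open>{0..T}\<close>, so
    the map acts on the complete space of bounded continuous functions on the whole line.\<close>
  define \<Phi> :: "(real \<Rightarrow>\<^sub>C 'a) \<Rightarrow> (real \<Rightarrow>\<^sub>C 'a)"
    where "\<Phi> w = Bcontfun (\<lambda>t. G (apply_bcontfun w) (clamp 0 T t))" for w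
  have \<Phi>: "apply_bcontfun (\<Phi> w) t = G (apply_bcontfun w) (clamp 0 T t)" for w t
  proof -
    have "continuous_on (cbox 0 T) (G (apply_bcontfun w))" by (rule Gcont) simp
    then have "(\<lambda>t. G (apply_bcontfun w) (clamp 0 T t)) \<in> bcontfun"
      unfolding bcontfun_def
      by (auto intro!: clamp_continuous_on clamp_bounded compact_imp_bounded[OF compact_continuous_image])
    then show ?thesis by (simp add: \<Phi>_def Bcontfun_inverse)
  qed
  have "dist (\<Phi> w) (\<Phi> v) \<le> 1/2 * dist w v" for w v
  proof (rule dist_bound)
    fix x
    define t where "t = clamp 0 T x"
    have t: "t \<in> {0..T}"
      unfolding t_def using clamp_in_interval[of 0 T x] \<open>0 < T\<close> by auto
    define d where "d = dist w v"
    have gw: "g w integrable_on {0..t}" and gv: "g v integrable_on {0..t}"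
      by (intro gint t; simp)+
    have gdiff: "norm (g w r - g v r) \<le> (L * d) * exp (K * r)" if "r \<in> {0..t}" for r
    proof -
      have "norm (g w r - g v r) \<le> L * norm (exp (K * r) *\<^sub>R w r - exp (K * r) *\<^sub>R v r)"
        unfolding g_def using that t by (intro lip) auto
      also have "\<dots> = L * (exp (K * r) * dist (w r) (v r))"
        by (simp add: dist_norm flip: scaleR_diff_right)
      also have "\<dots> \<le> L * (exp (K * r) * d)"
        using \<open>0 < L\<close> dist_bounded[of w r v] by (intro mult_left_mono) (auto simp: d_def)
      finally show ?thesis by (simp add: mult_ac)
    qed
    have exp_int: "((\<lambda>r. (L * d) * exp (K * r)) has_integral (L * d) * (exp (K * t) - 1) / K) {0..t}"
      using t by (intro has_integral_exp_scaled K) auto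
    have "norm (integral {0..t} (\<lambda>r. g w r - g v r)) \<le> integral {0..t} (\<lambda>r. (L * d) * exp (K * r))"
      using exp_int gdiff by (intro integral_norm_bound_integral integrable_diff gw gv) auto
    also have "\<dots> = d * (exp (K * t) - 1) / 2"
      using integral_unique[OF exp_int] \<open>0 < L\<close> by (simp add: K_def)
    also have "\<dots> \<le> d * exp (K * t) / 2"
      by (simp add: d_def mult_left_mono)
    finally have "exp (- K * t) * norm (integral {0..t} (\<lambda>r. g w r - g v r))
        \<le> exp (- K * t) * (d * exp (K * t) / 2)"
      by (intro mult_left_mono) auto
    also have "\<dots> = d / 2" by (simp add: exp_minus)
    finally have "exp (- K * t) * norm (integral {0..t} (\<lambda>r. g w r - g v r)) \<le> d / 2" .
    moreover have "dist (\<Phi> w x) (\<Phi> v x)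
        = exp (- K * t) * norm (integral {0..t} (\<lambda>r. g w r - g v r))"
      unfolding \<Phi> t_def[symmetric] dist_norm G_def integral_diff[OF gw gv]
      by (simp flip: scaleR_diff_right)
    ultimately show "dist (\<Phi> w x) (\<Phi> v x) \<le> 1/2 * dist w v"
      by (simp add: d_def)
  qed
  then obtain w where w: "\<Phi> w = w"
    using banach_fix_type[of "1/2" \<Phi>] by auto
  have wG: "w t = G w t" if "t \<in> {0..T}" for t
    using \<Phi>[of w t] w that by simp
  define z where "z t = exp (K * t) *\<^sub>R w t" for t
  have gz: "g w = (\<lambda>r. f r (z r))" by (auto simp: g_def z_def)
  show thesis
  proof
    show "continuous_on {0..T} z" unfolding z_def by (intro continuous_intros) auto
    show "(\<lambda>r. f r (z r)) integrable_on {0..T}" using gint[of w T] \<open>0 < T\<close> gz by auto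
    show "z t = z0 + integral {0..t} (\<lambda>r. f r (z r))" if "t \<in> {0..T}" for t
      using wG[OF that] unfolding z_def[of t] G_def gz
      by (simp flip: exp_add)
  qed
qed

section \<open>Existence for a single mode\<close>

text \<open>The second derivative is asked for only on \<open>{0<..T}\<close>, since
  \<open>q\<close> may have no limit at \<open>0\<close>, whereas \<open>y'\<close> must be
  continuous up to \<open>0\<close>.\<close>

definition mode_solution ::
  "real \<Rightarrow> (real \<Rightarrow> real) \<Rightarrow> (real \<Rightarrow> 'a::real_normed_vector) \<Rightarrow> (real \<Rightarrow> 'a) \<Rightarrow> bool" where
  "mode_solution T q y y' \<longleftrightarrow>
     (\<forall>t\<in>{0..T}. (y has_vector_derivative y' t) (at t within {0..T})) \<and>
     continuous_on {0..T} y' \<and>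
     (\<forall>t\<in>{0<..T}. (y' has_vector_derivative - q t *\<^sub>R y t) (at t within {0<..T}))"

lemma mode_solution_continuous:
  assumes "mode_solution T q y y'"
  shows "continuous_on {0..T} y" "continuous_on {0..T} y'"
  using assms unfolding mode_solution_def
  by (auto simp: continuous_on_eq_continuous_within intro: has_vector_derivative_continuous)

lemma mode_solution_interior:
  assumes "mode_solution T q y y'" "t \<in> {0<..<T}"
  shows "(y has_vector_derivative y' t) (at t)" "(y' has_vector_derivative - q t *\<^sub>R y t) (at t)"
proof -
  have "at t within {0..T} = at t" "at t within {0<..T} = at t"
    using assms(2) by (auto intro!: at_within_open_subset[of t "{0<..<T}"])
  then show "(y has_vector_derivative y' t) (at t)" "(y' has_vector_derivative - q t *\<^sub>R y t) (at t)"
    using assms unfolding mode_solution_def by (auto dest!: bspec[of _ _ t])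
qed

text \<open>The equation is solved as a first-order system for the pair \<open>(y, y')\<close>. Its
  integral form yields the derivative of \<open>y'\<close> away from \<open>0\<close>, and that of
  \<open>y\<close> also at \<open>0\<close>, because the integrand \<open>y'\<close> is continuous
  there.\<close>

lemma mode_solution_exists:
  fixes y0 y1 :: "'a::euclidean_space"
  assumes "0 < T" and q: "continuous_on {0<..T} q" and L: "\<And>t. t \<in> {0<..T} \<Longrightarrow> \<bar>q t\<bar> \<le> L"
  obtains y y' where "mode_solution T q y y'" "y 0 = y0" "y' 0 = y1"
proof -
  \<comment> \<open>Extension by zero makes the bound on the coefficient hold at
    \<open>t = 0\<close> as well; the value at one point does not affect the integrals.\<close>
  define p where "p t = (if t \<in> {0<..T} then q t else 0)" for t
  define f :: "real \<Rightarrow> 'a \<times> 'a \<Rightarrow> 'a \<times> 'a" where "f t z = (snd z, - p t *\<^sub>R fst z)" for t z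
  have L0: "0 \<le> L" using L[of T] \<open>0 < T\<close> by (auto intro: order_trans[OF abs_ge_zero])
  have pL: "\<bar>p t\<bar> \<le> L" for t using L L0 by (simp add: p_def)
  have "continuous_on {0<..T} p"
    using q by (rule continuous_on_eq) (simp add: p_def)
  then have fcont: "continuous_on {0<..T} (\<lambda>t. f t (z t))" if "continuous_on {0<..T} z" for z
    unfolding f_def by (intro continuous_intros that)
  have lip: "norm (f t x - f t y) \<le> (1 + L) * norm (x - y)" for t x y
  proof -
    have "norm (f t x - f t y) \<le> norm (snd (x - y)) + norm (p t *\<^sub>R fst (x - y))"
      using norm_Pair_le[of "snd (x - y)" "- p t *\<^sub>R fst (x - y)"]
      by (simp add: f_def algebra_simps norm_minus_commute)
    also have "\<dots> \<le> norm (x - y) + L * norm (x - y)"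
      using pL L0 norm_fst_le[of "fst (x - y)" "snd (x - y)"] norm_snd_le[of "snd (x - y)" "fst (x - y)"]
      unfolding prod.collapse norm_scaleR
      by (auto intro!: add_mono mult_mono)
    finally show ?thesis by (simp add: algebra_simps)
  qed
  obtain z where z: "continuous_on {0..T} z"
      "\<And>t. t \<in> {0..T} \<Longrightarrow> z t = (y0, y1) + integral {0..t} (\<lambda>r. f r (z r))"
      "(\<lambda>r. f r (z r)) integrable_on {0..T}"
    by (rule lipschitz_ode_exists[of T "1 + L" f "(y0, y1)"])
       (use \<open>0 < T\<close> L0 fcont lip in \<open>auto simp: f_def zero_prod_def\<close>)
  have dz: "(z has_vector_derivative f t (z t)) (at t within {0<..T})" if t: "t \<in> {0<..T}" for t
  proof -
    \<comment> \<open>The fundamental theorem is applied with \<open>0\<close> as exceptional point,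
      where the integrand may be discontinuous.\<close>
    have eq: "{0..T} - {0} = {0<..T}" by auto
    have "continuous_on {0<..T} (\<lambda>t. f t (z t))"
      by (intro fcont continuous_on_subset[OF z(1)]) auto
    then have "continuous (at t within {0..T} - {0}) (\<lambda>t. f t (z t))"
      using t unfolding eq by (simp add: continuous_on_eq_continuous_within)
    then have "((\<lambda>u. integral {0..u} (\<lambda>r. f r (z r))) has_vector_derivative f t (z t)) (at t within {0<..T})"
      using integral_has_vector_derivative_continuous_at[OF z(3), of t "{0}"] t by (simp add: eq)
    then have "((\<lambda>u. (y0, y1) + integral {0..u} (\<lambda>r. f r (z r))) has_vector_derivative f t (z t))
        (at t within {0<..T})"
      by (auto intro!: derivative_eq_intros)
    then show ?thesis
      by (rule has_vector_derivative_transform[OF t, rotated]) (simp add: z(2))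
  qed
  have csnd: "continuous_on {0..T} (\<lambda>t. snd (z t))" by (intro continuous_intros z)
  have fst_eq: "fst (z t) = y0 + integral {0..t} (\<lambda>r. snd (z r))" if t: "t \<in> {0..T}" for t
  proof -
    have "(\<lambda>r. f r (z r)) integrable_on {0..t}"
      by (rule integrable_subinterval_real[OF z(3)]) (use t in auto)
    from integral_linear[OF this bounded_linear_fst]
    have "fst (integral {0..t} (\<lambda>r. f r (z r))) = integral {0..t} (\<lambda>r. snd (z r))"
      by (simp add: o_def f_def)
    then show ?thesis using z(2)[OF t] by simp
  qed
  show thesis
  proof
    show "mode_solution T q (\<lambda>t. fst (z t)) (\<lambda>t. snd (z t))"
      unfolding mode_solution_def
    proof (intro conjI ballI csnd)
      fix t assume t: "t \<in> {0..T}"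
      have "((\<lambda>t. y0 + integral {0..t} (\<lambda>r. snd (z r))) has_vector_derivative snd (z t)) (at t within {0..T})"
        using integral_has_vector_derivative[OF csnd t] by (auto intro!: derivative_eq_intros)
      then show "((\<lambda>t. fst (z t)) has_vector_derivative snd (z t)) (at t within {0..T})"
        by (rule has_vector_derivative_transform[OF t, rotated]) (simp add: fst_eq)
    next
      fix t assume t: "t \<in> {0<..T}"
      have "((\<lambda>t. snd (z t)) has_vector_derivative snd (f t (z t))) (at t within {0<..T})"
        by (rule bounded_linear.has_vector_derivative[OF bounded_linear_snd dz[OF t]])
      then show "((\<lambda>t. snd (z t)) has_vector_derivative - q t *\<^sub>R fst (z t)) (at t within {0<..T})"
        using t by (simp add: f_def p_def)
    qed
  qed (use z(2)[of 0] \<open>0 < T\<close> in auto)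
qed


section \<open>Energy estimates for a single mode\<close>

lemma has_real_derivative_inner:
  fixes f g :: "real \<Rightarrow> 'a::real_inner"
  assumes "(f has_vector_derivative f') (at t within S)" "(g has_vector_derivative g') (at t within S)"
  shows "((\<lambda>t. f t \<bullet> g t) has_real_derivative f t \<bullet> g' + f' \<bullet> g t) (at t within S)"
  using bounded_bilinear.has_vector_derivative[OF bounded_bilinear_inner assms]
  by (simp add: has_real_derivative_iff_has_vector_derivative)

text \<open>Product rule with \<open>y'' = - q y\<close>. The three quadratic quantities form a
  closed system, and every energy below is a combination of them. For complex values the inner
  product is \<open>Re (y * cnj y')\<close>.\<close>

lemma mode_solution_inner_derivatives:
  fixes y :: "real \<Rightarrow> 'a::real_inner"
  assumes "mode_solution T q y y'" "t \<in> {0<..<T}"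
  shows "((\<lambda>t. y t \<bullet> y t) has_real_derivative 2 * (y t \<bullet> y' t)) (at t)"
    and "((\<lambda>t. y' t \<bullet> y' t) has_real_derivative - 2 * q t * (y t \<bullet> y' t)) (at t)"
    and "((\<lambda>t. y t \<bullet> y' t) has_real_derivative y' t \<bullet> y' t - q t * (y t \<bullet> y t)) (at t)"
  using has_real_derivative_inner[OF mode_solution_interior(1)[OF assms] mode_solution_interior(1)[OF assms]]
    has_real_derivative_inner[OF mode_solution_interior(2)[OF assms] mode_solution_interior(2)[OF assms]]
    has_real_derivative_inner[OF mode_solution_interior(1)[OF assms] mode_solution_interior(2)[OF assms]]
  by (simp_all add: inner_commute mult.assoc)

text \<open>Young's inequality with weights matched to the naive energy, from the square
  \<open>(norm y - l * b * norm x)\<^sup>2 / b \<ge> 0\<close>.\<close>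

lemma abs_inner_le_weighted:
  fixes x y :: "'a::real_inner"
  assumes "0 < l" "0 < b"
  shows "\<bar>x \<bullet> y\<bar> \<le> ((y \<bullet> y) / b + l\<^sup>2 * b * (x \<bullet> x)) / (2 * l)"
proof -
  have "0 \<le> (norm y - l * b * norm x)\<^sup>2 / b" using assms by simp
  also have "\<dots> = (y \<bullet> y) / b + l\<^sup>2 * b * (x \<bullet> x) - 2 * l * (norm x * norm y)"
    using assms by (simp add: field_simps power2_eq_square dot_square_norm)
  finally have "2 * l * (norm x * norm y) \<le> (y \<bullet> y) / b + l\<^sup>2 * b * (x \<bullet> x)" by simp
  moreover have "2 * l * \<bar>x \<bullet> y\<bar> \<le> 2 * l * (norm x * norm y)"
    using Cauchy_Schwarz_ineq2[of x y] assms by (intro mult_left_mono) auto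
  ultimately have "2 * l * \<bar>x \<bullet> y\<bar> \<le> (y \<bullet> y) / b + l\<^sup>2 * b * (x \<bullet> x)"
    by linarith
  then show ?thesis using assms by (simp add: pos_le_divide_eq mult_ac)
qed

text \<open>This is the energy conserved when \<open>b = 1\<close>. As \<open>b\<close> does not
  occur in it, it is continuous up to \<open>t = 0\<close> along solutions.\<close>

definition energy :: "real \<Rightarrow> (real \<Rightarrow> 'a::real_inner) \<Rightarrow> (real \<Rightarrow> 'a) \<Rightarrow> real \<Rightarrow> real" where
  "energy l y y' t = y' t \<bullet> y' t + l\<^sup>2 * (y t \<bullet> y t)"

lemma energy_nonneg: "0 \<le> energy l y y' t"
  by (simp add: energy_def)

text \<open>The derivative of the energy is
  \<open>2 * l\<^sup>2 * (1 - (b t)\<^sup>2) * (y t \<bullet> y' t)\<close>, at most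
  \<open>l * (1 + B)\<close> times the energy. No derivative of \<open>b\<close> enters, so the
  estimate can start at \<open>t = 0\<close>.\<close>

lemma energy_le_exp:
  fixes y :: "real \<Rightarrow> 'a::real_inner"
  assumes sol: "mode_solution T (\<lambda>t. l\<^sup>2 * (b t)\<^sup>2) y y'" and "0 < l"
    and b: "\<And>t. t \<in> {0<..T} \<Longrightarrow> (b t)\<^sup>2 \<le> B" and "t \<in> {0..T}"
  shows "energy l y y' t \<le> energy l y y' 0 * exp (l * (1 + B) * t)"
proof -
  define k where "k = l * (1 + B)"
  define H where "H \<tau> = energy l y y' \<tau> * exp (- k * \<tau>)" for \<tau>
  have "H t \<le> H 0"
  proof (rule DERIV_nonpos_imp_decreasing_open[where f = H])
    show "0 \<le> t" using assms by simp
    have "continuous_on {0..T} H"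
      unfolding H_def energy_def by (intro continuous_intros mode_solution_continuous[OF sol])
    then show "continuous_on {0..t} H" by (rule continuous_on_subset) (use assms in auto)
    fix x assume x: "0 < x" "x < t"
    then have xT: "x \<in> {0<..<T}" using assms by auto
    note d = mode_solution_inner_derivatives[OF sol xT]
    define e where "e = 2 * l\<^sup>2 * (1 - (b x)\<^sup>2) * (y x \<bullet> y' x) - k * energy l y y' x"
    have B0: "0 \<le> B" using b[of x] xT by (auto intro: order_trans[OF zero_le_power2])
    have "(H has_real_derivative e * exp (- k * x)) (at x)"
      unfolding H_def energy_def e_def
      by (auto intro!: derivative_eq_intros d simp: algebra_simps)
    moreover have "e \<le> 0"
    proof -
      have "2 * l\<^sup>2 * (1 - (b x)\<^sup>2) * (y x \<bullet> y' x) \<le> 2 * l\<^sup>2 * \<bar>1 - (b x)\<^sup>2\<bar> * \<bar>y x \<bullet> y' x\<bar>"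
        using abs_ge_self[of "2 * l\<^sup>2 * (1 - (b x)\<^sup>2) * (y x \<bullet> y' x)"] by (simp add: abs_mult)
      also have "\<dots> \<le> 2 * l\<^sup>2 * (1 + B) * (energy l y y' x / (2 * l))"
      proof (intro mult_mono)
        show "\<bar>1 - (b x)\<^sup>2\<bar> \<le> 1 + B" using B0 b[of x] xT by (auto simp: abs_le_iff intro: order_trans[of "- (b x)\<^sup>2" 0])
        show "\<bar>y x \<bullet> y' x\<bar> \<le> energy l y y' x / (2 * l)"
          using abs_inner_le_weighted[of l 1 "y x" "y' x"] \<open>0 < l\<close> by (simp add: energy_def)
        show "0 \<le> 2 * l\<^sup>2 * (1 + B)"
          using B0 by simp
      qed auto
      also have "\<dots> = k * energy l y y' x"
        using \<open>0 < l\<close> by (simp add: k_def power2_eq_square)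
      finally show ?thesis by (simp add: e_def)
    qed
    ultimately show "\<exists>D. (H has_real_derivative D) (at x) \<and> D \<le> 0"
      by (intro exI[of _ "e * exp (- k * x)"] conjI mult_nonpos_nonneg) auto
  qed
  then have "H t * exp (k * t) \<le> H 0 * exp (k * t)" by simp
  then show ?thesis by (simp add: H_def k_def mult.assoc flip: exp_add)
qed

text \<open>The naive energy \<open>|y'|\<^sup>2/b + l\<^sup>2 b |y|\<^sup>2\<close> has derivative \<open>- (b'/b\<^sup>2) (y \<bullet> y')'\<close>. Adding
  \<open>(b'/b\<^sup>2) (y \<bullet> y')\<close> integrates by parts, which gains a factor \<open>1/l\<close>: the new derivative is
  \<open>(b'/b\<^sup>2)' (y \<bullet> y')\<close>.\<close>

lemma energy_le_corrected:
  fixes y :: "real \<Rightarrow> 'a::real_inner" and b b' b'' :: "real \<Rightarrow> real"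
  assumes sol: "mode_solution T (\<lambda>t. l\<^sup>2 * (b t)\<^sup>2) y y'" and "0 < l" "0 < C1" "0 < C3"
    and b: "\<And>t. t \<in> {0<..T} \<Longrightarrow> C1 \<le> b t \<and> b t \<le> C2"
    and db: "\<And>t. t \<in> {0<..T} \<Longrightarrow> (b has_real_derivative b' t) (at t within {0<..T})"
    and ddb: "\<And>t. t \<in> {0<..T} \<Longrightarrow> (b' has_real_derivative b'' t) (at t within {0<..T})"
    and "0 < t0" "t0 \<le> t" "t \<le> T" "0 \<le> n"
    and b1: "\<And>t. t \<in> {t0..T} \<Longrightarrow> \<bar>b' t\<bar> \<le> C3 * (n / t)"
    and b2: "\<And>t. t \<in> {t0..T} \<Longrightarrow> \<bar>b'' t\<bar> \<le> C3 * (n / t)\<^sup>2"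
    and small: "C3 / C1\<^sup>2 * n \<le> l * t0"
    and D: "D = C3 / C1\<^sup>2 + 2 * C3\<^sup>2 / C1 ^ 3" and B: "B = 1 / C1 + C2"
  shows "energy l y y' t \<le> 3 * B\<^sup>2 * exp (D * n\<^sup>2 / (l * t0)) * energy l y y' t0"
proof -
  define E0 where "E0 \<tau> = (y' \<tau> \<bullet> y' \<tau>) / b \<tau> + l\<^sup>2 * b \<tau> * (y \<tau> \<bullet> y \<tau>)" for \<tau>
  define E1 where "E1 \<tau> = E0 \<tau> + b' \<tau> / (b \<tau>)\<^sup>2 * (y \<tau> \<bullet> y' \<tau>)" for \<tau>
  \<comment> \<open>\<open>a / x\<^sup>2\<close> will bound the relative growth rate of
    \<open>E1\<close> at \<open>x\<close>, and \<open>- a / x\<^sup>2\<close> is the derivative of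
    \<open>a / x\<close>; hence the integrating factor \<open>exp (a / \<tau>)\<close>.\<close>
  define a where "a = D * n\<^sup>2 / l"
  define H where "H \<tau> = E1 \<tau> * exp (a / \<tau>)" for \<tau>
  note pos = \<open>0 < l\<close> \<open>0 < C1\<close> \<open>0 < C3\<close> \<open>0 < t0\<close> \<open>t0 \<le> t\<close> \<open>t \<le> T\<close> \<open>0 \<le> n\<close>
  have D0: "0 \<le> D" using pos by (simp add: D)
  have C2: "0 < C2" using b[of T] \<open>0 < C1\<close> \<open>0 < t0\<close> \<open>t0 \<le> t\<close> \<open>t \<le> T\<close> by auto
  have bpos: "0 < b \<tau>" "C1 \<le> b \<tau>" "b \<tau> \<le> C2" if "\<tau> \<in> {t0..T}" for \<tau>
    using b[of \<tau>] that \<open>0 < t0\<close> \<open>0 < C1\<close> by auto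
  have E0nn: "0 \<le> E0 \<tau>" if "\<tau> \<in> {t0..T}" for \<tau>
    unfolding E0_def using bpos[OF that] by simp
  have inner: "\<bar>y \<tau> \<bullet> y' \<tau>\<bar> \<le> E0 \<tau> / (2 * l)" if "\<tau> \<in> {t0..T}" for \<tau>
    unfolding E0_def using abs_inner_le_weighted[OF \<open>0 < l\<close> bpos(1)[OF that]] .
  have quot: "\<bar>x / b \<tau> ^ k\<bar> \<le> X / C1 ^ k" if "\<bar>x\<bar> \<le> X" "\<tau> \<in> {t0..T}" for x X \<tau> and k :: nat
  proof -
    have "0 < C1 ^ k" "C1 ^ k \<le> b \<tau> ^ k"
      using bpos[OF that(2)] \<open>0 < C1\<close> by (auto intro: power_mono)
    then show ?thesis
      using that(1) by (auto simp: abs_divide abs_of_pos intro!: frac_le)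
  qed
  have corr: "\<bar>b' \<tau> / (b \<tau>)\<^sup>2 * (y \<tau> \<bullet> y' \<tau>)\<bar> \<le> E0 \<tau> / 2" if \<tau>: "\<tau> \<in> {t0..T}" for \<tau>
  proof -
    have "\<bar>b' \<tau> / (b \<tau>)\<^sup>2\<bar> \<le> C3 * (n / t0) / C1\<^sup>2"
    proof -
      have "\<bar>b' \<tau>\<bar> \<le> C3 * (n / \<tau>)" using b1[OF \<tau>] .
      also have "\<dots> \<le> C3 * (n / t0)"
        using \<tau> pos by (intro mult_left_mono divide_left_mono) auto
      finally show ?thesis by (rule quot[OF _ \<tau>])
    qed
    \<comment> \<open>This is the hypothesis \<open>small\<close> divided by \<open>t0\<close>. With
      the bound \<open>E0 \<tau> / (2 * l)\<close> on the inner product, the corrector is at most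
      half of \<open>E0 \<tau>\<close>.\<close>
    also have "\<dots> \<le> l" using small pos by (simp add: field_simps)
    finally have "\<bar>b' \<tau> / (b \<tau>)\<^sup>2\<bar> * \<bar>y \<tau> \<bullet> y' \<tau>\<bar> \<le> l * (E0 \<tau> / (2 * l))"
      using inner[OF \<tau>] \<open>0 < l\<close> by (intro mult_mono) auto
    then show ?thesis using \<open>0 < l\<close> by (simp add: abs_mult)
  qed
  \<comment> \<open>The corrected and the naive energy are comparable; the product of the factors 2
    and 3/2 is the 3 in the conclusion.\<close>
  have E1: "E0 \<tau> \<le> 2 * E1 \<tau>" "E1 \<tau> \<le> 3/2 * E0 \<tau>" if "\<tau> \<in> {t0..T}" for \<tau>
  proof -
    have "E0 \<tau> \<le> 2 * (E0 \<tau> + c)" "E0 \<tau> + c \<le> 3/2 * E0 \<tau>" if "\<bar>c\<bar> \<le> E0 \<tau> / 2" for c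
      using that unfolding abs_le_iff by argo+
    from this[OF corr[OF that]] show "E0 \<tau> \<le> 2 * E1 \<tau>" "E1 \<tau> \<le> 3/2 * E0 \<tau>"
      by (simp_all only: E1_def)
  qed
  have cont: "continuous_on {t0..t} b" "continuous_on {t0..t} b'"
    "continuous_on {t0..t} y" "continuous_on {t0..t} y'"
  proof -
    have "continuous_on {0<..T} b" "continuous_on {0<..T} b'"
      using db[THEN DERIV_continuous] ddb[THEN DERIV_continuous]
      by (auto simp: continuous_on_eq_continuous_within)
    moreover have "{t0..t} \<subseteq> {0<..T}" "{t0..t} \<subseteq> {0..T}" using pos by auto
    ultimately show "continuous_on {t0..t} b" "continuous_on {t0..t} b'"
      "continuous_on {t0..t} y" "continuous_on {t0..t} y'"
      using mode_solution_continuous[OF sol] by (blast intro: continuous_on_subset)+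
  qed
  have "H t \<le> H t0"
  proof (rule DERIV_nonpos_imp_decreasing_open[where f = H])
    show "t0 \<le> t" by fact
    show "continuous_on {t0..t} H"
    proof -
      have "b \<tau> \<noteq> 0" "\<tau> \<noteq> 0" if "\<tau> \<in> {t0..t}" for \<tau>
        using bpos(1)[of \<tau>] that pos by auto
      then show ?thesis
        unfolding H_def E1_def E0_def by (intro continuous_intros cont) auto
    qed
    fix x assume x: "t0 < x" "x < t"
    then have xT: "x \<in> {0<..<T}" "x \<in> {t0..T}" using pos by auto
    have at: "at x within {0<..T} = at x"
      using xT by (auto intro!: at_within_open_subset[of x "{0<..<T}"])
    note d = mode_solution_inner_derivatives[OF sol xT(1)]
    have d1: "(b has_real_derivative b' x) (at x)" "(b' has_real_derivative b'' x) (at x)"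
      using db[of x] ddb[of x] xT at by auto
    \<comment> \<open>The derivative of \<open>b' / b\<^sup>2\<close>. It alone survives in the
      derivative of \<open>E1\<close>: the terms in \<open>y' \<bullet> y'\<close> and
      \<open>y \<bullet> y\<close> cancel.\<close>
    define g' where "g' = b'' x / (b x)\<^sup>2 - 2 * (b' x)\<^sup>2 / (b x) ^ 3"
    have dE: "(E1 has_real_derivative g' * (y x \<bullet> y' x)) (at x)"
      unfolding E1_def E0_def g'_def using bpos[OF xT(2)]
      by (auto intro!: derivative_eq_intros d d1 simp: field_simps power2_eq_square power3_eq_cube)
    have "(H has_real_derivative (g' * (y x \<bullet> y' x) - a / x\<^sup>2 * E1 x) * exp (a / x)) (at x)"
      unfolding H_def using xT
      by (auto intro!: derivative_eq_intros dE simp: field_simps power2_eq_square)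
    moreover have "g' * (y x \<bullet> y' x) \<le> a / x\<^sup>2 * E1 x"
    proof -
      have "\<bar>b'' x / (b x)\<^sup>2\<bar> \<le> C3 * (n / x)\<^sup>2 / C1\<^sup>2"
        by (rule quot[OF b2[OF xT(2)] xT(2)])
      moreover have "\<bar>2 * (b' x)\<^sup>2 / (b x) ^ 3\<bar> \<le> 2 * (C3 * (n / x))\<^sup>2 / C1 ^ 3"
      proof -
        have "\<bar>b' x\<bar>\<^sup>2 \<le> (C3 * (n / x))\<^sup>2"
          by (rule power_mono[OF b1[OF xT(2)]]) simp
        then have "\<bar>2 * (b' x)\<^sup>2\<bar> \<le> 2 * (C3 * (n / x))\<^sup>2" by simp
        from quot[OF this xT(2)] show ?thesis .
      qed
      ultimately have "\<bar>g'\<bar> \<le> C3 * (n / x)\<^sup>2 / C1\<^sup>2 + 2 * (C3 * (n / x))\<^sup>2 / C1 ^ 3"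
        unfolding g'_def by linarith
      also have "\<dots> = D * (n / x)\<^sup>2"
        by (simp add: D algebra_simps add_divide_distrib power_divide power_mult_distrib)
      finally have "\<bar>g'\<bar> * \<bar>y x \<bullet> y' x\<bar> \<le> D * (n / x)\<^sup>2 * (E1 x / l)"
      proof (intro mult_mono)
        show "\<bar>y x \<bullet> y' x\<bar> \<le> E1 x / l"
          using inner[OF xT(2)] E1(1)[OF xT(2)] \<open>0 < l\<close> by (simp add: field_simps)
      qed (use D0 in auto)
      also have "\<dots> = a / x\<^sup>2 * E1 x"
        by (simp add: a_def power_divide)
      finally show ?thesis using abs_ge_self[of "g' * (y x \<bullet> y' x)"] by (simp add: abs_mult)
    qed
    ultimately show "\<exists>e. (H has_real_derivative e) (at x) \<and> e \<le> 0"
      by (intro exI[of _ "(g' * (y x \<bullet> y' x) - a / x\<^sup>2 * E1 x) * exp (a / x)"] conjI mult_nonpos_nonneg) auto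
  qed
  have t_in: "t \<in> {t0..T}" "t0 \<in> {t0..T}" using pos by auto
  have a0: "0 \<le> a" using D0 pos by (simp add: a_def)
  have E1t: "0 \<le> E1 t" using E1(1)[OF t_in(1)] E0nn[OF t_in(1)] by linarith
  have "E1 t \<le> H t"
    using mult_left_mono[OF _ E1t, of 1 "exp (a / t)"] a0 pos by (simp add: H_def)
  then have "E0 t \<le> 3 * exp (a / t0) * E0 t0"
  proof -
    have "E0 t \<le> 2 * E1 t" using E1(1)[OF t_in(1)] .
    also have "\<dots> \<le> 2 * (E1 t0 * exp (a / t0))"
      using \<open>E1 t \<le> H t\<close> \<open>H t \<le> H t0\<close> by (simp add: H_def)
    also have "\<dots> \<le> 2 * ((3/2 * E0 t0) * exp (a / t0))"
      using E1(2)[OF t_in(2)] by (intro mult_left_mono mult_right_mono) auto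
    finally show ?thesis by (simp add: mult_ac)
  qed
  \<comment> \<open>\<open>B\<close> dominates both \<open>b\<close> and \<open>1 / b\<close>, so it
    serves in both comparisons with the constant-coefficient energy; using both gives
    \<open>B\<^sup>2\<close>.\<close>
  have up: "E0 \<tau> \<le> B * energy l y y' \<tau>" and lo: "energy l y y' \<tau> \<le> B * E0 \<tau>"
    if \<tau>: "\<tau> \<in> {t0..T}" for \<tau>
  proof -
    note b = bpos[OF \<tau>]
    have "1 / b \<tau> \<le> 1 / C1" using b pos by (simp add: frac_le)
    then have w: "1 / b \<tau> \<le> B" "b \<tau> \<le> B" using b C2 pos by (auto simp: B add_increasing2 add_increasing)
    have "(1 / b \<tau>) * (y' \<tau> \<bullet> y' \<tau>) + b \<tau> * (l\<^sup>2 * (y \<tau> \<bullet> y \<tau>))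
        \<le> B * (y' \<tau> \<bullet> y' \<tau>) + B * (l\<^sup>2 * (y \<tau> \<bullet> y \<tau>))"
      using w by (intro add_mono mult_right_mono) auto
    then show "E0 \<tau> \<le> B * energy l y y' \<tau>"
      by (simp add: E0_def energy_def algebra_simps)
    have w': "1 \<le> B * (1 / b \<tau>)" "1 \<le> B * b \<tau>" using w b by (simp_all add: field_simps)
    have "1 * (y' \<tau> \<bullet> y' \<tau>) + 1 * (l\<^sup>2 * (y \<tau> \<bullet> y \<tau>))
        \<le> B * (1 / b \<tau>) * (y' \<tau> \<bullet> y' \<tau>) + B * b \<tau> * (l\<^sup>2 * (y \<tau> \<bullet> y \<tau>))"
      using w' by (intro add_mono mult_right_mono) auto
    then show "energy l y y' \<tau> \<le> B * E0 \<tau>"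
      by (simp add: E0_def energy_def algebra_simps)
  qed
  have "0 \<le> B" using pos C2 by (simp add: B)
  have "energy l y y' t \<le> B * (3 * exp (a / t0) * E0 t0)"
    using lo[OF t_in(1)] mult_left_mono[OF \<open>E0 t \<le> 3 * exp (a / t0) * E0 t0\<close> \<open>0 \<le> B\<close>]
    by linarith
  also have "\<dots> \<le> B * (3 * exp (a / t0) * (B * energy l y y' t0))"
    using up[OF t_in(2)] \<open>0 \<le> B\<close> by (intro mult_left_mono) auto
  finally show ?thesis by (simp add: a_def power2_eq_square mult_ac)
qed

section \<open>Uniqueness for a single mode\<close>

lemma mode_solution_diff:
  assumes "mode_solution T q y y'" "mode_solution T q z z'"
  shows "mode_solution T q (\<lambda>t. y t - z t) (\<lambda>t. y' t - z' t)"
proof -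
  have "((\<lambda>t. y' t - z' t) has_vector_derivative - q t *\<^sub>R (y t - z t)) (at t within {0<..T})"
    if "t \<in> {0<..T}" for t
    using assms that unfolding mode_solution_def
    by (auto intro!: derivative_eq_intros simp: algebra_simps)
  then show ?thesis
    using assms unfolding mode_solution_def
    by (auto intro!: derivative_eq_intros continuous_intros)
qed

text \<open>The difference of the solutions has zero initial energy, and the exponential bound keeps
  it zero.\<close>

lemma mode_solution_unique:
  fixes y z :: "real \<Rightarrow> 'a::real_inner"
  assumes sol: "mode_solution T (\<lambda>t. l\<^sup>2 * (b t)\<^sup>2) y y'" "mode_solution T (\<lambda>t. l\<^sup>2 * (b t)\<^sup>2) z z'"
    and "0 < l" and b: "\<And>t. t \<in> {0<..T} \<Longrightarrow> (b t)\<^sup>2 \<le> B"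
    and init: "y 0 = z 0" "y' 0 = z' 0" and "t \<in> {0..T}"
  shows "y t = z t"
proof -
  have "energy l (\<lambda>t. y t - z t) (\<lambda>t. y' t - z' t) t \<le> 0"
    using energy_le_exp[OF mode_solution_diff[OF sol] \<open>0 < l\<close> b \<open>t \<in> {0..T}\<close>] init
    by (simp add: energy_def)
  then have "l\<^sup>2 * ((y t - z t) \<bullet> (y t - z t)) \<le> 0"
    using inner_ge_zero[of "y' t - z' t"] unfolding energy_def by linarith
  then show ?thesis
    using \<open>0 < l\<close> inner_ge_zero[of "y t - z t"]
    by (auto simp: mult_le_0_iff simp del: inner_ge_zero dest!: order_antisym)
qed


section \<open>Solutions as eigenfunction expansions\<close>

text \<open>With \<open>x = 2 ^ P / l\<close> this is the time separating the two energy estimates.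
  The map \<open>t / \<nu> t\<close> is injective, as its numerator grows and its denominator falls,
  and the intermediate value theorem provides a preimage of \<open>x\<close>. Beyond its range,
  where \<open>mu_inv\<close> defaults to \<open>T\<close>, the inequality remains.\<close>

lemma mu_inv_cases:
  assumes "0 < T" and cont: "continuous_on {0<..T} \<nu>"
    and pos: "\<And>t. t \<in> {0<..T} \<Longrightarrow> 0 < \<nu> t" and anti: "strict_antimono_on {0<..T} \<nu>"
    and "0 < C4" and C4: "\<And>t. t \<in> {0<..T} \<Longrightarrow> C4 \<le> \<nu> t" and "0 < x"
  defines "\<tau> \<equiv> mu_inv \<nu> T x"
  shows "\<tau> \<in> {0<..T}" "\<tau> \<le> x * \<nu> \<tau>" "\<tau> = T \<or> \<tau> = x * \<nu> \<tau>"
proof -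
  have "\<tau> \<in> {0<..T} \<and> \<tau> \<le> x * \<nu> \<tau> \<and> (\<tau> = T \<or> \<tau> = x * \<nu> \<tau>)"
  proof (cases "x \<le> T / \<nu> T")
    case True
    \<comment> \<open>A left endpoint where the map is at most \<open>x\<close>:
      \<open>\<nu> e \<ge> C4\<close> gives \<open>e / \<nu> e \<le> e / C4 \<le> x\<close>.\<close>
    define e where "e = min T (x * C4)"
    have e: "0 < e" "e \<le> T" using assms by (auto simp: e_def)
    have "e / \<nu> e \<le> x"
    proof -
      have "x * C4 \<le> x * \<nu> e" using C4[of e] e \<open>0 < x\<close> by (intro mult_left_mono) auto
      then show ?thesis using pos[of e] e by (simp add: e_def field_simps)
    qed
    moreover have "continuous_on {e..T} (\<lambda>t. t / \<nu> t)"
    proof -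
      have sub: "{e..T} \<subseteq> {0<..T}" using e by auto
      then have "\<nu> t \<noteq> 0" if "t \<in> {e..T}" for t using pos[of t] that by auto
      then show ?thesis
        by (intro continuous_intros continuous_on_subset[OF cont sub]) auto
    qed
    ultimately obtain t where t: "e \<le> t" "t \<le> T" "t / \<nu> t = x"
      using IVT'[of "\<lambda>t. t / \<nu> t" e x T] True e by auto
    have "inj_on (\<lambda>t. t / \<nu> t) {0<..T}"
    proof (rule strict_mono_on_imp_inj_on, rule strict_mono_onI)
      fix r s assume rs: "r \<in> {0<..T}" "s \<in> {0<..T}" "r < s"
      then have "\<nu> s < \<nu> r" using anti by (auto simp: monotone_on_def)
      then show "r / \<nu> r < s / \<nu> s"
        using rs pos[of s] by (intro frac_less) auto
    qed
    then have "\<tau> = t"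
      unfolding \<tau>_def mu_inv_def using True t e by (auto intro!: the_inv_into_f_eq)
    then show ?thesis using t e pos[of t] by (auto simp: field_simps)
  next
    case False
    then have "\<tau> = T" by (simp add: \<tau>_def mu_inv_def)
    then show ?thesis using False pos[of T] \<open>0 < T\<close> by (auto simp: field_simps)
  qed
  then show "\<tau> \<in> {0<..T}" "\<tau> \<le> x * \<nu> \<tau>" "\<tau> = T \<or> \<tau> = x * \<nu> \<tau>" by auto
qed

section \<open>Continuity in time with values in the weighted spaces\<close>

text \<open>The majorant \<open>M\<close> does not depend on time, so the series for the squared
  norm of the increment converges uniformly and is continuous in time; at \<open>\<tau> = t\<close>
  all its terms vanish.\<close>

lemma continuous_into_weightedI:
  assumes cont: "\<And>k. continuous_on {0..T} (\<lambda>t. v t k)"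
    and bound: "\<And>k t. t \<in> {0..T} \<Longrightarrow>
      lam k powr (2 * s) * F (lam k) powr (-2) * (cmod (v t k))\<^sup>2 \<le> M k"
    and M: "summable M"
  shows "continuous_into_weighted T lam F s v"
  unfolding continuous_into_weighted_def
proof (intro conjI ballI)
  define w where "w k = lam k powr (2 * s) * F (lam k) powr (-2)" for k
  have w: "0 \<le> w k" for k by (simp add: w_def)
  fix t assume t: "t \<in> {0..T}"
  show "v t \<in> weighted_space lam F s"
    unfolding weighted_space_def mem_Collect_eq
    by (rule summable_comparison_test'[OF M, of 0]) (use bound[OF t] in auto)
  define h where "h k \<tau> = w k * (cmod (v \<tau> k - v t k))\<^sup>2" for k \<tau>
  \<comment> \<open>The 4 comes from
    \<open>(p + q)\<^sup>2 \<le> 2 * p\<^sup>2 + 2 * q\<^sup>2\<close>, both weighted squares being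
    at most \<open>M k\<close>.\<close>
  have "norm (h k \<tau>) \<le> 4 * M k" if \<tau>: "\<tau> \<in> {0..T}" for k \<tau>
  proof -
    have "(cmod (v \<tau> k - v t k))\<^sup>2 \<le> (cmod (v \<tau> k) + cmod (v t k))\<^sup>2"
      by (intro power_mono norm_triangle_ineq4) auto
    also have "\<dots> \<le> 2 * (cmod (v \<tau> k))\<^sup>2 + 2 * (cmod (v t k))\<^sup>2"
      using zero_le_power2[of "cmod (v \<tau> k) - cmod (v t k)"]
      by (simp add: power2_sum power2_diff del: zero_le_power2)
    finally have "w k * (cmod (v \<tau> k - v t k))\<^sup>2 \<le> w k * (2 * (cmod (v \<tau> k))\<^sup>2 + 2 * (cmod (v t k))\<^sup>2)"
      using w by (rule mult_left_mono)
    also have "\<dots> = 2 * (w k * (cmod (v \<tau> k))\<^sup>2) + 2 * (w k * (cmod (v t k))\<^sup>2)"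
      by (simp add: algebra_simps)
    also have "\<dots> \<le> 2 * M k + 2 * M k"
      using bound[OF \<tau>, of k] bound[OF t, of k] unfolding w_def by linarith
    finally show ?thesis using w[of k] by (simp add: h_def)
  qed
  then have "uniform_limit {0..T} (\<lambda>n \<tau>. \<Sum>k<n. h k \<tau>) (\<lambda>\<tau>. \<Sum>k. h k \<tau>) sequentially"
    using summable_mult[OF M] by (rule Weierstrass_m_test)
  then have "continuous_on {0..T} (\<lambda>\<tau>. \<Sum>k. h k \<tau>)"
    by (rule uniform_limit_theorem[rotated])
       (auto intro!: always_eventually continuous_intros cont simp: h_def)
  then have "((\<lambda>\<tau>. sqrt (\<Sum>k. h k \<tau>)) \<longlongrightarrow> sqrt (\<Sum>k. h k t)) (at t within {0..T})"
    using t by (auto simp: continuous_on_def intro: tendsto_real_sqrt)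
  then show "((\<lambda>\<tau>. weighted_norm lam F s (\<lambda>k. v \<tau> k - v t k)) \<longlongrightarrow> 0) (at t within {0..T})"
    by (simp add: h_def w_def weighted_norm_def)
qed

lemma mode_solution_time_deriv:
  assumes "0 < T" "mode_solution T q (\<lambda>t. u t k) y'" "t \<in> {0..T}"
  shows "time_deriv T u t k = y' t"
  using assms unfolding time_deriv_def mode_solution_def
  by (auto intro!: vector_derivative_within_closed_interval)

text \<open>The equation forces the witness \<open>w\<close> to be
  \<open>- (lam k)\<^sup>2 * (b t)\<^sup>2\<close> times \<open>u t k\<close>, which is continuous
  because \<open>b\<close> and the coefficient are.\<close>

lemma expansion_solution_iff:
  assumes "0 < T" and b: "continuous_on {0<..T} b"
  shows "expansion_solution \<Omega> lam \<phi> T b u0 u1 u \<longleftrightarrow>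
    (\<forall>k. mode_solution T (\<lambda>t. (lam k)\<^sup>2 * (b t)\<^sup>2) (\<lambda>t. u t k) (\<lambda>t. time_deriv T u t k) \<and>
      u 0 k = fourier_coeff \<Omega> \<phi> u0 k \<and> time_deriv T u 0 k = fourier_coeff \<Omega> \<phi> u1 k)"
proof -
  have "((\<forall>t\<in>{0..T}. (\<lambda>\<tau>. u \<tau> k) differentiable (at t within {0..T})) \<and>
      continuous_on {0..T} (\<lambda>t. time_deriv T u t k) \<and>
      (\<exists>w. continuous_on {0<..T} w \<and> (\<forall>t\<in>{0<..T}.
           ((\<lambda>\<tau>. time_deriv T u \<tau> k) has_vector_derivative w t) (at t within {0<..T}) \<and>
           w t + of_real ((lam k)\<^sup>2 * (b t)\<^sup>2) * u t k = 0))) \<longleftrightarrow>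
    mode_solution T (\<lambda>t. (lam k)\<^sup>2 * (b t)\<^sup>2) (\<lambda>t. u t k) (\<lambda>t. time_deriv T u t k)" (is "?L \<longleftrightarrow> ?R") for k
  proof
    assume ?L
    then obtain w where w: "\<And>t. t \<in> {0<..T} \<Longrightarrow>
        ((\<lambda>\<tau>. time_deriv T u \<tau> k) has_vector_derivative w t) (at t within {0<..T})"
      "\<And>t. t \<in> {0<..T} \<Longrightarrow> w t + of_real ((lam k)\<^sup>2 * (b t)\<^sup>2) * u t k = 0" by blast
    have "w t = - ((lam k)\<^sup>2 * (b t)\<^sup>2) *\<^sub>R u t k" if "t \<in> {0<..T}" for t
      using w(2)[OF that] by (simp add: scaleR_conv_of_real eq_neg_iff_add_eq_0)
    then show ?R
      using \<open>?L\<close> w(1) unfolding mode_solution_def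
      by (auto simp: time_deriv_def vector_derivative_works)
  next
    assume R: ?R
    define w where "w t = - ((lam k)\<^sup>2 * (b t)\<^sup>2) *\<^sub>R u t k" for t
    have "continuous_on {0<..T} w"
      unfolding w_def
      by (intro continuous_intros b continuous_on_subset[OF mode_solution_continuous(1)[OF R]]) auto
    moreover have "\<forall>t\<in>{0<..T}. ((\<lambda>\<tau>. time_deriv T u \<tau> k) has_vector_derivative w t) (at t within {0<..T}) \<and>
           w t + of_real ((lam k)\<^sup>2 * (b t)\<^sup>2) * u t k = 0"
      using R by (auto simp: mode_solution_def w_def scaleR_conv_of_real)
    ultimately show ?L
      using R unfolding mode_solution_def by (blast intro: differentiableI_vector)
  qed
  then show ?thesis unfolding expansion_solution_def by auto
qed

section \<open>Energy bounds uniform in the frequency\<close>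

locale oscillating_coefficient =
  fixes T C1 C2 C3 C4 :: real and b b' b'' \<nu> :: "real \<Rightarrow> real"
  assumes T_pos: "0 < T" and C1_pos: "0 < C1"
    and b_bounds: "\<And>t. t \<in> {0<..T} \<Longrightarrow> C1 \<le> b t \<and> b t \<le> C2"
    and \<nu>_cont: "continuous_on {0<..T} \<nu>"
    and \<nu>_pos: "\<And>t. t \<in> {0<..T} \<Longrightarrow> 0 < \<nu> t"
    and \<nu>_anti: "strict_antimono_on {0<..T} \<nu>"
    and C4_pos: "0 < C4" and \<nu>_ge: "\<And>t. t \<in> {0<..T} \<Longrightarrow> C4 \<le> \<nu> t"
    and b_deriv: "\<And>t. t \<in> {0<..T} \<Longrightarrow> (b has_real_derivative b' t) (at t within {0<..T})"
    and b'_deriv: "\<And>t. t \<in> {0<..T} \<Longrightarrow> (b' has_real_derivative b'' t) (at t within {0<..T})"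
    and C3_pos: "0 < C3"
    and b'_bound: "\<And>t. t \<in> {0<..T} \<Longrightarrow> \<bar>b' t\<bar> \<le> C3 * (\<nu> t / t)"
    and b''_bound: "\<And>t. t \<in> {0<..T} \<Longrightarrow> \<bar>b'' t\<bar> \<le> C3 * (\<nu> t / t)\<^sup>2"
begin

lemma b_square_le: "t \<in> {0<..T} \<Longrightarrow> (b t)\<^sup>2 \<le> C2\<^sup>2"
  using b_bounds[of t] C1_pos by (intro power_mono) auto

lemma b_cont: "continuous_on {0<..T} b"
  using b_deriv[THEN DERIV_continuous] by (auto simp: continuous_on_eq_continuous_within)

text \<open>The constant \<open>D\<close> of the corrected estimate: the derivative of
  \<open>b' / b\<^sup>2\<close> is at most this times \<open>(\<nu> t / t)\<^sup>2\<close> in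
  absolute value.\<close>

definition corrector_bound :: real where
  "corrector_bound = C3 / C1\<^sup>2 + 2 * C3\<^sup>2 / C1 ^ 3"

text \<open>The exponents of the early and the late phase, each divided by
  \<open>\<nu> \<tau>\<close>, after \<open>l * \<tau>\<close> is replaced by
  \<open>2 ^ P * \<nu> \<tau>\<close>.\<close>

definition loss_rate :: "nat \<Rightarrow> real" where
  "loss_rate P = (1 + C2\<^sup>2) * 2 ^ P + corrector_bound / 2 ^ P"

text \<open>The second summand is the prefactor of the late phase; the 1 covers the early phase,
  which has no larger prefactor.\<close>

definition energy_factor :: real where
  "energy_factor = 1 + 3 * (1 / C1 + C2)\<^sup>2"

lemma corrector_bound_pos: "0 < corrector_bound"
  using C1_pos C3_pos by (simp add: corrector_bound_def add_pos_pos)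

lemma loss_rate_pos: "0 < loss_rate P"
  using corrector_bound_pos by (simp add: loss_rate_def add_nonneg_pos)

text \<open>Up to the splitting time \<open>\<tau>\<close> the exponential bound applies. Later the
  corrected bound is started from the early bound at \<open>\<tau>\<close>, so that the two
  exponents add up.\<close>

lemma energy_le_loss:
  fixes y :: "real \<Rightarrow> 'a::real_inner"
  assumes sol: "mode_solution T (\<lambda>t. l\<^sup>2 * (b t)\<^sup>2) y y'" and l: "0 < l"
    and P: "C3 / C1\<^sup>2 \<le> 2 ^ P" and t: "t \<in> {0..T}"
  shows "energy l y y' t
    \<le> energy_factor * exp (loss_rate P * \<nu> (mu_inv \<nu> T (2 ^ P / l))) * energy l y y' 0"
proof -
  define \<tau> where "\<tau> = mu_inv \<nu> T (2 ^ P / l)"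
  note cases = mu_inv_cases[OF T_pos \<nu>_cont \<nu>_pos \<nu>_anti C4_pos \<nu>_ge, of "2 ^ P / l", folded \<tau>_def]
  have \<tau>: "\<tau> \<in> {0<..T}" "l * \<tau> \<le> 2 ^ P * \<nu> \<tau>" "\<tau> = T \<or> l * \<tau> = 2 ^ P * \<nu> \<tau>"
    using cases l by (auto simp: field_simps)
  have n: "0 < \<nu> \<tau>" using \<nu>_pos[OF \<tau>(1)] .
  define E where "E = energy l y y' 0"
  have E: "0 \<le> E" by (simp add: E_def energy_nonneg)
  have early: "energy l y y' r \<le> exp ((1 + C2\<^sup>2) * 2 ^ P * \<nu> \<tau>) * E" if r: "r \<in> {0..\<tau>}" for r
  proof -
    have "l * r \<le> l * \<tau>" using r l by simp
    then have "(1 + C2\<^sup>2) * (l * r) \<le> (1 + C2\<^sup>2) * (2 ^ P * \<nu> \<tau>)"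
      using \<tau>(2) by (intro mult_left_mono) auto
    then have "exp (l * (1 + C2\<^sup>2) * r) \<le> exp ((1 + C2\<^sup>2) * 2 ^ P * \<nu> \<tau>)" by (simp add: mult_ac)
    from mult_right_mono[OF this E]
    have "E * exp (l * (1 + C2\<^sup>2) * r) \<le> exp ((1 + C2\<^sup>2) * 2 ^ P * \<nu> \<tau>) * E"
      by (simp only: mult.commute)
    moreover have "energy l y y' r \<le> E * exp (l * (1 + C2\<^sup>2) * r)"
      unfolding E_def using r \<tau>(1) by (intro energy_le_exp[OF sol l b_square_le]) auto
    ultimately show ?thesis by (rule order_trans[rotated])
  qed
  show ?thesis
  proof (cases "t \<le> \<tau>")
    case True
    have "(1 + C2\<^sup>2) * 2 ^ P * \<nu> \<tau> \<le> loss_rate P * \<nu> \<tau>"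
      using n corrector_bound_pos by (intro mult_right_mono) (auto simp: loss_rate_def)
    then have "1 * exp ((1 + C2\<^sup>2) * 2 ^ P * \<nu> \<tau>) \<le> energy_factor * exp (loss_rate P * \<nu> \<tau>)"
      by (intro mult_mono) (auto simp: energy_factor_def)
    then have "exp ((1 + C2\<^sup>2) * 2 ^ P * \<nu> \<tau>) * E \<le> energy_factor * exp (loss_rate P * \<nu> \<tau>) * E"
      using E by (intro mult_right_mono) auto
    then show ?thesis
      using early[of t] True t by (simp add: \<tau>_def E_def)
  next
    case False
    \<comment> \<open>\<open>t > \<tau>\<close> rules out the default \<open>\<tau> = T\<close>, so
      the equation for \<open>\<tau>\<close> is available.\<close>
    then have l\<tau>: "l * \<tau> = 2 ^ P * \<nu> \<tau>" using \<tau>(3) t by auto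
    \<comment> \<open>As \<open>\<nu>\<close> decreases, \<open>\<nu> \<tau>\<close> dominates it on
      \<open>{\<tau>..T}\<close> and can be the constant \<open>n\<close> of the corrected
      estimate.\<close>
    have \<nu>_le: "0 \<le> \<nu> r / r" "\<nu> r / r \<le> \<nu> \<tau> / r" "r \<in> {0<..T}" if r: "r \<in> {\<tau>..T}" for r
    proof -
      show rT: "r \<in> {0<..T}" using r \<tau>(1) by auto
      have "\<nu> r \<le> \<nu> \<tau>"
        using \<nu>_anti \<tau>(1) rT r by (cases "r = \<tau>") (auto simp: monotone_on_def less_imp_le)
      then show "0 \<le> \<nu> r / r" "\<nu> r / r \<le> \<nu> \<tau> / r"
        using rT \<nu>_pos[OF rT] by (auto simp: divide_right_mono)
    qed
    have "energy l y y' t \<le> 3 * (1 / C1 + C2)\<^sup>2 * exp (corrector_bound * (\<nu> \<tau>)\<^sup>2 / (l * \<tau>)) * energy l y y' \<tau>"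
    proof (rule energy_le_corrected[OF sol l C1_pos C3_pos b_bounds b_deriv b'_deriv])
      show "\<bar>b' r\<bar> \<le> C3 * (\<nu> \<tau> / r)" if "r \<in> {\<tau>..T}" for r
        using b'_bound[OF \<nu>_le(3)[OF that]] mult_left_mono[OF \<nu>_le(2)[OF that], of C3] C3_pos by linarith
      show "\<bar>b'' r\<bar> \<le> C3 * (\<nu> \<tau> / r)\<^sup>2" if "r \<in> {\<tau>..T}" for r
        using b''_bound[OF \<nu>_le(3)[OF that]] C3_pos
          mult_left_mono[OF power_mono[OF \<nu>_le(2)[OF that] \<nu>_le(1)[OF that], of 2], of C3] by linarith
      \<comment> \<open>Once \<open>l * \<tau> = 2 ^ P * \<nu> \<tau>\<close> is inserted, this is
        the lower bound on \<open>2 ^ P\<close>.\<close>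
      show "C3 / C1\<^sup>2 * \<nu> \<tau> \<le> l * \<tau>"
        unfolding l\<tau> using P n by (intro mult_right_mono) auto
      show "corrector_bound = C3 / C1\<^sup>2 + 2 * C3\<^sup>2 / C1 ^ 3" by (rule corrector_bound_def)
      show "0 < \<tau>" "\<tau> \<le> t" "t \<le> T" "0 \<le> \<nu> \<tau>"
        using False t \<tau>(1) n by simp_all
    qed simp_all
    \<comment> \<open>The definition of \<open>\<tau>\<close> cancels one power of
      \<open>\<nu> \<tau>\<close>, which leaves a loss of the same form as the early one.\<close>
    also have "corrector_bound * (\<nu> \<tau>)\<^sup>2 / (l * \<tau>) = corrector_bound / 2 ^ P * \<nu> \<tau>"
      unfolding l\<tau> using n by (simp add: power2_eq_square)
    also have "3 * (1 / C1 + C2)\<^sup>2 * exp (corrector_bound / 2 ^ P * \<nu> \<tau>) * energy l y y' \<tau>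
        \<le> energy_factor * exp (corrector_bound / 2 ^ P * \<nu> \<tau>) * (exp ((1 + C2\<^sup>2) * 2 ^ P * \<nu> \<tau>) * E)"
      using early[of \<tau>] \<tau>(1) by (intro mult_mono) (auto simp: energy_factor_def energy_nonneg)
    also have "\<dots> = energy_factor * exp (loss_rate P * \<nu> \<tau>) * E"
      by (simp add: loss_rate_def distrib_right exp_add)
    finally show ?thesis by (simp add: \<tau>_def E_def)
  qed
qed

text \<open>Since \<open>l powr (2 * s) = l powr (2 * (s - 1)) * l\<^sup>2\<close>, the energy times
  \<open>l powr (2 * (s - 1))\<close> controls both squares at once. \<open>M\<close> involves
  initial values only and becomes the summable majorant.\<close>

lemma weighted_energy_le:
  fixes y :: "real \<Rightarrow> complex" and s :: real
  assumes sol: "mode_solution T (\<lambda>t. l\<^sup>2 * (b t)\<^sup>2) y y'" and l: "0 < l"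
    and P: "C3 / C1\<^sup>2 \<le> 2 ^ P" and t: "t \<in> {0..T}"
  defines "M \<equiv> energy_factor * (l powr (2 * (s - 1)) * (cmod (y' 0))\<^sup>2 + l powr (2 * s) * (cmod (y 0))\<^sup>2)"
  shows "l powr (2 * s) * loss_weight \<nu> T P (loss_rate P) l powr (-2) * (cmod (y t))\<^sup>2 \<le> M"
    and "l powr (2 * (s - 1)) * loss_weight \<nu> T P (loss_rate P) l powr (-2) * (cmod (y' t))\<^sup>2 \<le> M"
proof -
  define W where "W = loss_weight \<nu> T P (loss_rate P) l"
  have W: "1 \<le> W"
  proof -
    have "0 < \<nu> (mu_inv \<nu> T (2 ^ P / l))"
      using mu_inv_cases(1)[OF T_pos \<nu>_cont \<nu>_pos \<nu>_anti C4_pos \<nu>_ge] l by (intro \<nu>_pos) auto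
    then show ?thesis using loss_rate_pos[of P] by (simp add: W_def loss_weight_def)
  qed
  have cmod_energy: "energy l y y' r = (cmod (y' r))\<^sup>2 + l\<^sup>2 * (cmod (y r))\<^sup>2" for r
    by (simp add: energy_def dot_square_norm)
  have powr_l: "l powr (2 * s) = l powr (2 * (s - 1)) * l\<^sup>2"
  proof -
    have "l powr (2 * s) = l powr (2 * (s - 1) + 2)" by simp
    also have "\<dots> = l powr (2 * (s - 1)) * l powr 2" by (rule powr_add)
    finally show ?thesis using l by simp
  qed
  \<comment> \<open>The energy bound costs one power of \<open>W\<close> while the squared norm
    supplies two; \<open>1 \<le> W\<close> absorbs the spare one.\<close>
  have WW: "W powr (-2) * W \<le> 1"
  proof -
    have "W powr (-2) * W = W powr (-2) * W powr 1" using W by simp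
    also have "\<dots> = W powr (- 2 + 1)" by (rule powr_add[symmetric])
    also have "\<dots> \<le> W powr 0" by (intro powr_mono W) simp
    finally show ?thesis using W by simp
  qed
  have fac: "0 \<le> energy_factor" by (simp add: energy_factor_def)
  have "l powr (2 * (s - 1)) * W powr (-2) * energy l y y' t
      \<le> l powr (2 * (s - 1)) * W powr (-2) * (energy_factor * W * energy l y y' 0)"
    using energy_le_loss[OF sol l P t] by (intro mult_left_mono) (auto simp: W_def loss_weight_def)
  also have "\<dots> = (W powr (-2) * W) * (energy_factor * (l powr (2 * (s - 1)) * energy l y y' 0))"
    by (simp only: mult_ac)
  also have "\<dots> \<le> 1 * (energy_factor * (l powr (2 * (s - 1)) * energy l y y' 0))"
    using WW fac by (intro mult_right_mono mult_nonneg_nonneg energy_nonneg) auto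
  also have "\<dots> = M"
    by (simp add: M_def cmod_energy powr_l distrib_left mult.assoc)
  finally have main: "l powr (2 * (s - 1)) * W powr (-2) * energy l y y' t \<le> M" .
  have nonneg: "0 \<le> l powr (2 * (s - 1)) * W powr (-2)" by simp
  have "l powr (2 * s) * W powr (-2) * (cmod (y t))\<^sup>2
      = l powr (2 * (s - 1)) * W powr (-2) * (l\<^sup>2 * (cmod (y t))\<^sup>2)"
    unfolding powr_l by (simp only: mult_ac)
  also have "\<dots> \<le> l powr (2 * (s - 1)) * W powr (-2) * energy l y y' t"
    by (intro mult_left_mono nonneg) (simp add: cmod_energy)
  finally show "l powr (2 * s) * loss_weight \<nu> T P (loss_rate P) l powr (-2) * (cmod (y t))\<^sup>2 \<le> M"
    using main by (simp add: W_def)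
  have "l powr (2 * (s - 1)) * W powr (-2) * (cmod (y' t))\<^sup>2
      \<le> l powr (2 * (s - 1)) * W powr (-2) * energy l y y' t"
    by (intro mult_left_mono nonneg) (simp add: cmod_energy)
  then show "l powr (2 * (s - 1)) * loss_weight \<nu> T P (loss_rate P) l powr (-2) * (cmod (y' t))\<^sup>2 \<le> M"
    using main by (simp add: W_def)
qed

section \<open>Existence and uniqueness of the expansion\<close>

text \<open>Each mode is solved separately. Membership of \<open>u0\<close> and \<open>u1\<close> in
  spaces of order \<open>s\<close> and \<open>s - 1\<close> is what makes the majorants of the
  weighted energies summable over the modes.\<close>

lemma solution_exists:
  fixes \<Omega> :: "(real^'n) set"
  assumes lam: "\<And>k. 0 < lam k" and P: "C3 / C1\<^sup>2 \<le> 2 ^ P"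
    and u0: "u0 \<in> Hs_space \<Omega> lam \<phi> s" and u1: "u1 \<in> Hs_space \<Omega> lam \<phi> (s - 1)"
  obtains u where "expansion_solution \<Omega> lam \<phi> T b u0 u1 u"
    and "continuous_into_weighted T lam (loss_weight \<nu> T P (loss_rate P)) s u"
    and "continuous_into_weighted T lam (loss_weight \<nu> T P (loss_rate P)) (s - 1) (time_deriv T u)"
proof -
  have "\<exists>y y'. mode_solution T (\<lambda>t. (lam k)\<^sup>2 * (b t)\<^sup>2) y y' \<and>
      y 0 = fourier_coeff \<Omega> \<phi> u0 k \<and> y' 0 = fourier_coeff \<Omega> \<phi> u1 k" for k
  proof -
    have cont: "continuous_on {0<..T} (\<lambda>t. (lam k)\<^sup>2 * (b t)\<^sup>2)"
      by (intro continuous_intros b_cont)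
    have "\<bar>(lam k)\<^sup>2 * (b t)\<^sup>2\<bar> \<le> (lam k)\<^sup>2 * C2\<^sup>2" if "t \<in> {0<..T}" for t
      using b_square_le[OF that] by (simp add: abs_mult mult_left_mono)
    then obtain y y' where "mode_solution T (\<lambda>t. (lam k)\<^sup>2 * (b t)\<^sup>2) y y'"
        "y 0 = fourier_coeff \<Omega> \<phi> u0 k" "y' 0 = fourier_coeff \<Omega> \<phi> u1 k"
      by (rule mode_solution_exists[OF T_pos cont])
    then show ?thesis by blast
  qed
  then have "\<forall>k. \<exists>z. mode_solution T (\<lambda>t. (lam k)\<^sup>2 * (b t)\<^sup>2) (fst z) (snd z) \<and>
      fst z 0 = fourier_coeff \<Omega> \<phi> u0 k \<and> snd z 0 = fourier_coeff \<Omega> \<phi> u1 k"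
    by simp
  from choice[OF this] obtain z where z: "\<And>k. mode_solution T (\<lambda>t. (lam k)\<^sup>2 * (b t)\<^sup>2) (fst (z k)) (snd (z k)) \<and>
      fst (z k) 0 = fourier_coeff \<Omega> \<phi> u0 k \<and> snd (z k) 0 = fourier_coeff \<Omega> \<phi> u1 k"
    by blast
  define y y' where "y k = fst (z k)" and "y' k = snd (z k)" for k
  have y: "\<And>k. mode_solution T (\<lambda>t. (lam k)\<^sup>2 * (b t)\<^sup>2) (y k) (y' k)"
      "\<And>k. y k 0 = fourier_coeff \<Omega> \<phi> u0 k" "\<And>k. y' k 0 = fourier_coeff \<Omega> \<phi> u1 k"
    using z by (simp_all add: y_def y'_def)
  define u where "u t k = y k t" for t k
  have deriv: "time_deriv T u t k = y' k t" if "t \<in> {0..T}" for t k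
    using T_pos y(1)[of k] that by (intro mode_solution_time_deriv) (auto simp: u_def)
  \<comment> \<open>The chosen \<open>y' k\<close> is known to agree with \<open>time_deriv\<close>
    on \<open>{0..T}\<close>, so derivatives and continuity are transferred within that
    interval.\<close>
  have sol: "mode_solution T (\<lambda>t. (lam k)\<^sup>2 * (b t)\<^sup>2) (\<lambda>t. u t k) (\<lambda>t. time_deriv T u t k)" for k
  proof -
    have "continuous_on {0..T} (\<lambda>t. time_deriv T u t k)"
      using mode_solution_continuous(2)[OF y(1)] by (rule continuous_on_eq) (simp add: deriv)
    moreover have "((\<lambda>t. time_deriv T u t k) has_vector_derivative D) (at t within {0<..T})"
      if "(y' k has_vector_derivative D) (at t within {0<..T})" "t \<in> {0<..T}" for t D
      using that(2) _ that(1) by (rule has_vector_derivative_transform) (simp add: deriv)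
    ultimately show ?thesis
      using y(1)[of k] unfolding mode_solution_def u_def
      by (auto simp: deriv[unfolded u_def])
  qed
  have init: "u 0 k = fourier_coeff \<Omega> \<phi> u0 k" "time_deriv T u 0 k = fourier_coeff \<Omega> \<phi> u1 k" for k
    using y T_pos by (auto simp: u_def deriv)
  define M where "M k = energy_factor * (lam k powr (2 * (s - 1)) * (cmod (time_deriv T u 0 k))\<^sup>2
      + lam k powr (2 * s) * (cmod (u 0 k))\<^sup>2)" for k
  have M: "summable M"
    unfolding M_def init using u0 u1 by (intro summable_mult summable_add) (auto simp: Hs_space_def)
  note bounds = weighted_energy_le[where s = s, OF sol lam P, folded M_def]
  show thesis
  proof
    show "expansion_solution \<Omega> lam \<phi> T b u0 u1 u"
      by (simp add: expansion_solution_iff[OF T_pos b_cont] sol init)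
    show "continuous_into_weighted T lam (loss_weight \<nu> T P (loss_rate P)) s u"
      by (rule continuous_into_weightedI[OF mode_solution_continuous(1)[OF sol] bounds(1) M])
    show "continuous_into_weighted T lam (loss_weight \<nu> T P (loss_rate P)) (s - 1) (time_deriv T u)"
      by (rule continuous_into_weightedI[OF mode_solution_continuous(2)[OF sol] bounds(2) M])
  qed
qed

text \<open>Both expansions have the Fourier coefficients of the same data as initial values, so
  mode uniqueness applies for each \<open>k\<close>.\<close>

lemma solution_unique:
  fixes \<Omega> :: "(real^'n) set"
  assumes lam: "\<And>k. 0 < lam k"
    and "expansion_solution \<Omega> lam \<phi> T b u0 u1 u" "expansion_solution \<Omega> lam \<phi> T b u0 u1 v"
    and "t \<in> {0..T}"
  shows "v t = u t"
proof
  fix k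
  note iff = expansion_solution_iff[OF T_pos b_cont]
  show "v t k = u t k"
  proof (rule mode_solution_unique[OF _ _ lam b_square_le])
    show "mode_solution T (\<lambda>t. (lam k)\<^sup>2 * (b t)\<^sup>2) (\<lambda>t. v t k) (\<lambda>t. time_deriv T v t k)"
      "mode_solution T (\<lambda>t. (lam k)\<^sup>2 * (b t)\<^sup>2) (\<lambda>t. u t k) (\<lambda>t. time_deriv T u t k)"
      "v 0 k = u 0 k" "time_deriv T v 0 k = time_deriv T u 0 k"
      using assms(2,3) by (simp_all add: iff)
  qed (use assms in simp_all)
qed

end

theorem theorem1p1:
  fixes \<Omega> :: "(real^'n) set"
    and A :: "real^'n \<Rightarrow> real^'n"
    and lam :: "nat \<Rightarrow> real"
    and \<phi> :: "nat \<Rightarrow> real^'n \<Rightarrow> complex"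
    and b b' b'' \<nu> :: "real \<Rightarrow> real"
    and T s C1 C2 C3 C4 :: real
  assumes "open \<Omega>" and "bounded \<Omega>" and "C2_boundary \<Omega>"
    and "\<And>j. C1_closure \<Omega> (\<lambda>x. A x $ j)"
    and "Dirichlet_eigenbasis \<Omega> A lam \<phi>"
    and "0 < T"
    and "0 < C1" and "0 < C2" and "\<And>t. t \<in> {0<..T} \<Longrightarrow> C1 \<le> b t \<and> b t \<le> C2"
    and "continuous_on {0<..T} \<nu>"
    and "\<And>t. t \<in> {0<..T} \<Longrightarrow> 0 < \<nu> t"
    and "strict_antimono_on {0<..T} \<nu>"
    and "0 < C4" and "\<And>t. t \<in> {0<..T} \<Longrightarrow> C4 \<le> \<nu> t"
    and "\<And>t. t \<in> {0<..T} \<Longrightarrow> (b has_real_derivative b' t) (at t within {0<..T})"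
    and "\<And>t. t \<in> {0<..T} \<Longrightarrow> (b' has_real_derivative b'' t) (at t within {0<..T})"
    and "continuous_on {0<..T} b''"
    and "0 < C3"
    and "\<And>t. t \<in> {0<..T} \<Longrightarrow> \<bar>b' t\<bar> \<le> C3 * (\<nu> t / t)"
    and "\<And>t. t \<in> {0<..T} \<Longrightarrow> \<bar>b'' t\<bar> \<le> C3 * (\<nu> t / t)\<^sup>2"
    and "1 \<le> s"
  shows "\<exists>(P::nat) > 0. \<exists>c1 > 0.
    \<forall>u0 \<in> Hs_space \<Omega> lam \<phi> s. \<forall>u1 \<in> Hs_space \<Omega> lam \<phi> (s - 1).
      let sol = (\<lambda>u. expansion_solution \<Omega> lam \<phi> T b u0 u1 u \<and>
                  continuous_into_weighted T lam (loss_weight \<nu> T P c1) s u \<and>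
                  continuous_into_weighted T lam (loss_weight \<nu> T P c1) (s - 1) (time_deriv T u))
      in \<exists>u. sol u \<and> (\<forall>v. sol v \<longrightarrow> (\<forall>t\<in>{0..T}. v t = u t))"
proof -
  interpret oscillating_coefficient T C1 C2 C3 C4 b b' b'' \<nu>
    by (rule oscillating_coefficient.intro; rule assms; assumption)
  have lam: "\<And>k. 0 < lam k"
    using \<open>Dirichlet_eigenbasis \<Omega> A lam \<phi>\<close> unfolding Dirichlet_eigenbasis_def by blast
  \<comment> \<open>\<open>P\<close> will be \<open>Suc m\<close>, which is positive even if
    \<open>m = 0\<close> and preserves the inequality. It depends only on
    \<open>C3 / C1\<^sup>2\<close>, and \<open>c1\<close> is then \<open>loss_rate P\<close>; both
    are fixed before the initial data.\<close>
  obtain m where m: "C3 / C1\<^sup>2 < 2 ^ m"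
    using real_arch_pow[of 2 "C3 / C1\<^sup>2"] by auto
  have "(2::real) ^ m \<le> 2 ^ Suc m" by simp
  with m have P: "C3 / C1\<^sup>2 \<le> 2 ^ Suc m" by linarith
  show ?thesis
  proof (intro exI conjI ballI)
    show "0 < Suc m" "0 < loss_rate (Suc m)" by (simp_all add: loss_rate_pos)
    fix u0 u1 assume "u0 \<in> Hs_space \<Omega> lam \<phi> s" "u1 \<in> Hs_space \<Omega> lam \<phi> (s - 1)"
    then obtain u where u: "expansion_solution \<Omega> lam \<phi> T b u0 u1 u"
        "continuous_into_weighted T lam (loss_weight \<nu> T (Suc m) (loss_rate (Suc m))) s u"
        "continuous_into_weighted T lam (loss_weight \<nu> T (Suc m) (loss_rate (Suc m))) (s - 1) (time_deriv T u)"
      by (rule solution_exists[where lam = lam, OF lam P])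
    then show "let sol = (\<lambda>u. expansion_solution \<Omega> lam \<phi> T b u0 u1 u \<and>
          continuous_into_weighted T lam (loss_weight \<nu> T (Suc m) (loss_rate (Suc m))) s u \<and>
          continuous_into_weighted T lam (loss_weight \<nu> T (Suc m) (loss_rate (Suc m))) (s - 1) (time_deriv T u))
        in \<exists>u. sol u \<and> (\<forall>v. sol v \<longrightarrow> (\<forall>t\<in>{0..T}. v t = u t))"
      unfolding Let_def by (intro exI[of _ u] conjI allI impI ballI solution_unique[where lam = lam]) (auto intro: lam)
  qed
qed

end
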